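(* (i) One has $$\bar\lambda_2(\mathcal M^+)=\Lambda\frac{(\tilde N_+-2)^2}{4},$$ and the function $u(x)=r^{-\frac{\tilde N_+-2}{2}}(-\ln r)$ is an explicit solution of $$\mathcal M^+(D^2u)+\bar\lambda_2(\mathcal M^+)\frac{u}{r^2}=0\ \text{ in }B(0,1)\setminus\{0\},\qquad u=0\ \text{ on }\partial B(0,1).$$ Analogously, $$\bar\lambda_2(\mathcal M^-)=\lambda\frac{(\tilde N_--2)^2}{4},$$ and the function $u(x)=r^{-\frac{\tilde N_--2}{2}}(-\ln r)$ is an explicit solution of $$\mathcal M^-(D^2u)+\bar\lambda_2(\mathcal M^-)\frac{u}{r^2}=0\ \text{ in }B(0,1)\setminus\{0\},\qquad u=0\ \text{ on }\partial B(0,1).$$ (ii) The eigenvalues $\bar\lambda_2(\mathcal M^\pm)$ are stable under the following regularizations: $$\bar\lambda_2(\mathcal M^\pm)=\lim_{\gamma\to2^-}\bar\lambda_\gamma(\mathcal M^\pm),\qquad \bar\lambda_2(\mathcal M^\pm)=\lim_{\delta\to0}\bar\lambda\Big(\mathcal M^\pm,\frac1{r^2},B(0,1)\setminus\overline{B(0,\delta)}\Big),$$ $$\bar\lambda_2(\mathcal M^\pm)=\lim_{\epsilon\to0}\bar\lambda\Big(\mathcal M^\pm,\frac{1}{r^2+\epsilon^2},B(0,1)\Big).$$ (iii) For every continuous $F:\mathcal S_N\to\mathbb R$ such that $\lambda\,\mathrm{tr}(M')\le F(M+M')-F(M)\le\Lambda\,\mathrm{tr}(M')$ for all $M,M'\in\mathcal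 S_N$ with $M'$ positive semidefinite, and $F(tM)=tF(M)$ for all $t>0$ and $M\in\mathcal S_N$, one has $$\Lambda\frac{(\tilde N_+-2)^2}{4}\le\bar\lambda_2(F)\le\lambda\frac{(\tilde N_--2)^2}{4}.$$
   Context: $B(0,t)$ is the open ball of radius $t$ centered at $0$ in $\mathbb R^N$, $r=|x|$, and $\mathcal S_N$ is the set of symmetric $N\times N$ matrices. Constants $\Lambda\ge\lambda>0$ are fixed. Writing $M=M^+-M^-$ with $M^\pm$ positive semidefinite and $M^+M^-=0$, Pucci's operators are $$\mathcal M^+(M)=\Lambda\,\mathrm{tr}(M^+)-\lambda\,\mathrm{tr}(M^-),\qquad \mathcal M^-(M)=\lambda\,\mathrm{tr}(M^+)-\Lambda\,\mathrm{tr}(M^-).$$ Set $\tilde N_+=\frac{\lambda}{\Lambda}(N-1)+1$ and $\tilde N_-=\frac{\Lambda}{\lambda}(N-1)+1$. Standing assumption: $\tilde N_+>2$. For an operator $F$ on $\mathcal S_N$, a domain $\Omega$ and a positive continuous potential $f$ on $\Omega$, $$\bar\lambda(F,f,\Omega)=\sup\{\mu:\ \exists\,u\in C(\Omega),\ u>0\text{ in }\Omega,\ F(D^2u)+\mu f u\le0\text{ in }\Omega\},$$ the inequality being in the viscosity sense. For $\gamma>0$, $\bar\lambda_\gamma(F)=\bar\lambda(F,r^{-\gamma},B(0,1)\setminus\{0\})$; in particular $\bar\lambda_2(F)$ corresponds to $\gamma=2$. *)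

theory Defs
  imports "HOL-Analysis.Analysis" "HOL-Library.Extended_Real"
begin

definition sym_mats :: "(real^'n^'n) set" where
  "sym_mats = {M. transpose M = M}"

definition psd :: "real^'n^'n \<Rightarrow> bool" where
  "psd M \<longleftrightarrow> M \<in> sym_mats \<and> (\<forall>x. 0 \<le> x \<bullet> (M *v x))"

definition pos_neg_decomp :: "real^'n^'n \<Rightarrow> real^'n^'n \<Rightarrow> real^'n^'n \<Rightarrow> bool" where
  "pos_neg_decomp M P Q \<longleftrightarrow> psd P \<and> psd Q \<and> P ** Q = 0 \<and> M = P - Q"

(* For symmetric M the decomposition exists and is unique, so the descriptions below are
   meaningful; for other matrices their values are never used. *)
definition mat_pos_part :: "real^'n^'n \<Rightarrow> real^'n^'n" where
  "mat_pos_part M = (THE P. \<exists>Q. pos_neg_decomp M P Q)"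

definition mat_neg_part :: "real^'n^'n \<Rightarrow> real^'n^'n" where
  "mat_neg_part M = (THE Q. \<exists>P. pos_neg_decomp M P Q)"

definition pucci_plus :: "real \<Rightarrow> real \<Rightarrow> real^'n^'n \<Rightarrow> real" where
  "pucci_plus lam Lam M = Lam * trace (mat_pos_part M) - lam * trace (mat_neg_part M)"

definition pucci_minus :: "real \<Rightarrow> real \<Rightarrow> real^'n^'n \<Rightarrow> real" where
  "pucci_minus lam Lam M = lam * trace (mat_pos_part M) - Lam * trace (mat_neg_part M)"

definition Ntilde_plus :: "real \<Rightarrow> real \<Rightarrow> nat \<Rightarrow> real" where
  "Ntilde_plus lam Lam N = lam / Lam * (real N - 1) + 1"

definition Ntilde_minus :: "real \<Rightarrow> real \<Rightarrow> nat \<Rightarrow> real" where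
  "Ntilde_minus lam Lam N = Lam / lam * (real N - 1) + 1"

text \<open>\<open>C2_with_hessian U \<phi> H\<close>: \<open>\<phi>\<close> is of class \<open>C\<^sup>2\<close> on the open set \<open>U\<close>, with Hessian
  \<open>D\<^sup>2\<phi> = H\<close> there; \<open>g\<close> is the gradient.\<close>

definition C2_with_hessian ::
  "(real^'n) set \<Rightarrow> (real^'n \<Rightarrow> real) \<Rightarrow> (real^'n \<Rightarrow> real^'n^'n) \<Rightarrow> bool" where
  "C2_with_hessian U \<phi> H \<longleftrightarrow> open U \<and> continuous_on U H \<and>
     (\<exists>g. \<forall>x\<in>U. (\<phi> has_derivative (\<lambda>h. g x \<bullet> h)) (at x) \<and>
                (g has_derivative (\<lambda>h. H x *v h)) (at x))"

text \<open>Viscosity inequalities \<open>F(D\<^sup>2u) + \<mu> f u \<le> 0\<close> (supersolution) and \<open>\<ge> 0\<close> (subsolution)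
  in \<open>\<Omega>\<close>, for continuous \<open>u\<close>. Since the neighbourhood \<open>U\<close> is arbitrary, an extremum of \<open>u - \<phi>\<close>
  over \<open>U\<close> is the same as a local extremum.\<close>

definition visc_supersol ::
  "(real^'n^'n \<Rightarrow> real) \<Rightarrow> real \<Rightarrow> (real^'n \<Rightarrow> real) \<Rightarrow> (real^'n) set \<Rightarrow> (real^'n \<Rightarrow> real) \<Rightarrow> bool" where
  "visc_supersol F \<mu> f \<Omega> u \<longleftrightarrow> continuous_on \<Omega> u \<and>
     (\<forall>x0\<in>\<Omega>. \<forall>U \<phi> H. x0 \<in> U \<longrightarrow> U \<subseteq> \<Omega> \<longrightarrow> C2_with_hessian U \<phi> H \<longrightarrow>
        (\<forall>x\<in>U. u x0 - \<phi> x0 \<le> u x - \<phi> x) \<longrightarrow> F (H x0) + \<mu> * f x0 * u x0 \<le> 0)"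

definition visc_subsol ::
  "(real^'n^'n \<Rightarrow> real) \<Rightarrow> real \<Rightarrow> (real^'n \<Rightarrow> real) \<Rightarrow> (real^'n) set \<Rightarrow> (real^'n \<Rightarrow> real) \<Rightarrow> bool" where
  "visc_subsol F \<mu> f \<Omega> u \<longleftrightarrow> continuous_on \<Omega> u \<and>
     (\<forall>x0\<in>\<Omega>. \<forall>U \<phi> H. x0 \<in> U \<longrightarrow> U \<subseteq> \<Omega> \<longrightarrow> C2_with_hessian U \<phi> H \<longrightarrow>
        (\<forall>x\<in>U. u x - \<phi> x \<le> u x0 - \<phi> x0) \<longrightarrow> 0 \<le> F (H x0) + \<mu> * f x0 * u x0)"

definition visc_sol ::
  "(real^'n^'n \<Rightarrow> real) \<Rightarrow> real \<Rightarrow> (real^'n \<Rightarrow> real) \<Rightarrow> (real^'n) set \<Rightarrow> (real^'n \<Rightarrow> real) \<Rightarrow> bool" where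
  "visc_sol F \<mu> f \<Omega> u \<longleftrightarrow> visc_supersol F \<mu> f \<Omega> u \<and> visc_subsol F \<mu> f \<Omega> u"

text \<open>The supremum is taken in the extended reals, so that it is meaningful without knowing in
  advance that the set of admissible \<open>\<mu>\<close> is nonempty and bounded above.\<close>

definition princ_eig ::
  "(real^'n^'n \<Rightarrow> real) \<Rightarrow> (real^'n \<Rightarrow> real) \<Rightarrow> (real^'n) set \<Rightarrow> ereal" where
  "princ_eig F f \<Omega> = Sup (ereal ` {\<mu>. \<exists>u. continuous_on \<Omega> u \<and> (\<forall>x\<in>\<Omega>. 0 < u x) \<and>
                                          visc_supersol F \<mu> f \<Omega> u})"

definition princ_eig_gamma :: "real \<Rightarrow> (real^'n^'n \<Rightarrow> real) \<Rightarrow> ereal" where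
  "princ_eig_gamma \<gamma> F = princ_eig F (\<lambda>x. norm x powr (-\<gamma>)) (ball 0 1 - {0})"

text \<open>\<open>u\<close> is continuous up to the unit sphere, vanishes on it, and solves
  \<open>F(D\<^sup>2u) + \<mu> u / r\<^sup>2 = 0\<close> in the punctured unit ball.\<close>

definition solves_punctured_dirichlet ::
  "(real^'n^'n \<Rightarrow> real) \<Rightarrow> real \<Rightarrow> (real^'n \<Rightarrow> real) \<Rightarrow> bool" where
  "solves_punctured_dirichlet F \<mu> u \<longleftrightarrow>
     visc_sol F \<mu> (\<lambda>x. 1 / (norm x)\<^sup>2) (ball 0 1 - {0}) u \<and>
     continuous_on (cball 0 1 - {0}) u \<and> (\<forall>x\<in>sphere 0 1. u x = 0)"

definition unif_elliptic :: "real \<Rightarrow> real \<Rightarrow> (real^'n^'n \<Rightarrow> real) \<Rightarrow> bool" where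
  "unif_elliptic lam Lam F \<longleftrightarrow>
     (\<forall>M\<in>sym_mats. \<forall>M'\<in>sym_mats. psd M' \<longrightarrow>
        lam * trace M' \<le> F (M + M') - F M \<and> F (M + M') - F M \<le> Lam * trace M')"

definition pos_homogeneous :: "(real^'n^'n \<Rightarrow> real) \<Rightarrow> bool" where
  "pos_homogeneous F \<longleftrightarrow> (\<forall>t>0. \<forall>M\<in>sym_mats. F (t *\<^sub>R M) = t * F M)"

end

theory Submission
  imports Defs
begin

text \<open>
  Both Pucci operators have the form \<open>F = c tr(M\<^sup>+) - d tr(M\<^sup>-)\<close>. With \<open>\<tau>\<close> given by
  \<open>d (N - 1) = c (2 \<tau> + 1)\<close>, i.e. \<open>\<tau> = (N~ - 2) / 2\<close>, a decreasing convex radial function \<open>u\<close> satisfies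
  \<open>F(D\<^sup>2u) = c (u'' + (2 \<tau> + 1) u' / r)\<close>, so \<open>r powr -\<tau> * (- ln r)\<close> is a solution for \<open>\<mu> = c \<tau>\<^sup>2\<close>.
  This gives all lower bounds, except for the potential \<open>1 / (r\<^sup>2 + \<epsilon>\<^sup>2)\<close> on the whole ball, for which
  \<open>(r\<^sup>2 + \<epsilon>\<^sup>2) powr (-\<tau>/2)\<close> is a supersolution.

  For the upper bounds no comparison principle is needed: if \<open>\<mu>' > c \<tau>\<^sup>2\<close> and \<open>\<kappa>\<close> is small, then
  \<open>v = (cos (\<kappa> (ln r - s))) powr (1/\<kappa>)\<close> satisfies \<open>F(D\<^sup>2v) + \<mu>' v / r\<^sup>2 \<ge> 0\<close> on the annulus where
  it is positive, and it vanishes on the boundary. If \<open>u > 0\<close> is a supersolution for some larger \<open>\<mu>\<close>,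
  then at a maximum point of \<open>v / u\<close> a multiple of the smooth function \<open>v\<close> touches \<open>u\<close> from below,
  which is a contradiction. Since \<open>v\<close> lives on a fixed compact annulus in the punctured ball,
  the bound survives small perturbations of the domain and of the potential.

  A general \<open>F\<close> as in (iii) lies between the two Pucci operators.
\<close>

section \<open>Symmetric matrices\<close>

text \<open>Maximise the Rayleigh quotient over the unit sphere of \<open>S\<close>. Moving the
  maximiser \<open>e\<close> in the direction of the residual \<open>h = f e - l e\<close> changes
  the quotient to first order by a multiple of \<open>h \<bullet> h\<close>, so maximality forces
  \<open>h = 0\<close>.\<close>

lemma selfadjoint_eigenvector:
  fixes f :: "'a::euclidean_space \<Rightarrow> 'a"
  assumes lin: "linear f" and sa: "\<And>x y. f x \<bullet> y = x \<bullet> f y"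
    and S: "subspace S" and inv: "\<And>x. x \<in> S \<Longrightarrow> f x \<in> S" and ne: "S \<noteq> {0}"
  obtains e l where "e \<in> S" "norm e = 1" "f e = l *\<^sub>R e"
proof -
  from S have "0 \<in> S" by (rule subspace_0)
  with ne obtain x where x: "x \<in> S" "x \<noteq> 0" by blast
  have ne': "S \<inter> sphere 0 1 \<noteq> {}"
    using x subspace_scale[OF S x(1), of "inverse (norm x)"] by auto
  have "compact (S \<inter> sphere 0 1)"
    using closed_subspace[OF S] compact_sphere closed_Int_compact by blast
  then have "\<exists>e\<in>S \<inter> sphere 0 1. \<forall>y\<in>S \<inter> sphere 0 1. y \<bullet> f y \<le> e \<bullet> f e"
    using ne'
  proof (rule continuous_attains_sup)
    show "continuous_on (S \<inter> sphere 0 1) (\<lambda>x. x \<bullet> f x)"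
    by (intro continuous_intros linear_continuous_on linear_conv_bounded_linear[THEN iffD1] lin)
  qed
  then obtain e where e: "e \<in> S" "norm e = 1"
    and max: "\<And>y. y \<in> S \<Longrightarrow> norm y = 1 \<Longrightarrow> y \<bullet> f y \<le> e \<bullet> f e"
    by auto
  define l where "l = e \<bullet> f e"
  have ge: "y \<bullet> f y \<le> l * (y \<bullet> y)" if "y \<in> S" for y
  proof (cases "y = 0")
    case True
    then show ?thesis using linear_0[OF lin] by simp
  next
    case False
    have "(inverse (norm y) *\<^sub>R y) \<bullet> f (inverse (norm y) *\<^sub>R y) \<le> l"
      unfolding l_def using False subspace_scale[OF S that] by (intro max) auto
    then have "(y \<bullet> f y) / (norm y)\<^sup>2 \<le> l"
      by (simp add: linear_scale[OF lin] power2_eq_square divide_inverse mult_ac)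
    then show ?thesis using False by (simp add: divide_le_eq power2_norm_eq_inner)
  qed
  define h where "h = f e - l *\<^sub>R e"
  have hS: "h \<in> S" unfolding h_def using e inv S by (intro subspace_diff subspace_scale) auto
  define g where "g = l * (h \<bullet> h) - h \<bullet> f h"
  have "0 \<le> g" using ge[OF hS] by (simp add: g_def)
  have quad: "2 * t * (h \<bullet> h) \<le> t\<^sup>2 * g" for t
  proof -
    have "e + t *\<^sub>R h \<in> S" using e hS S by (intro subspace_add subspace_scale) auto
    from ge[OF this] have "(e + t *\<^sub>R h) \<bullet> f (e + t *\<^sub>R h) \<le> l * ((e + t *\<^sub>R h) \<bullet> (e + t *\<^sub>R h))" .
    moreover have "(e + t *\<^sub>R h) \<bullet> f (e + t *\<^sub>R h) = l + 2 * t * (h \<bullet> f e) + t\<^sup>2 * (h \<bullet> f h)"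
      using sa[of e h]
      by (simp add: linear_add[OF lin] linear_scale[OF lin] inner_simps l_def power2_eq_square
          algebra_simps inner_commute)
    moreover have "(e + t *\<^sub>R h) \<bullet> (e + t *\<^sub>R h) = 1 + 2 * t * (h \<bullet> e) + t\<^sup>2 * (h \<bullet> h)"
      using e by (simp add: inner_simps power2_eq_square algebra_simps inner_commute norm_eq_1)
    moreover have "h \<bullet> f e = h \<bullet> h + l * (h \<bullet> e)"
    proof -
      have "f e = h + l *\<^sub>R e" by (simp add: h_def)
      then show ?thesis by (simp add: inner_simps)
    qed
    ultimately have "l + 2 * t * (h \<bullet> h + l * (h \<bullet> e)) + t\<^sup>2 * (h \<bullet> f h)
        \<le> l * (1 + 2 * t * (h \<bullet> e) + t\<^sup>2 * (h \<bullet> h))"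
      by simp
    then show ?thesis by (simp add: g_def algebra_simps)
  qed
  have "h \<bullet> h \<le> 0"
  proof (rule ccontr)
    assume "\<not> h \<bullet> h \<le> 0"
    \<comment> \<open>For this \<open>t\<close> the bound \<open>quad\<close> fails; the
      \<open>+ 1\<close> covers \<open>g = 0\<close>.\<close>
    define t where "t = (h \<bullet> h) / (g + 1)"
    have t: "t > 0" "t * g < h \<bullet> h" using \<open>\<not> h \<bullet> h \<le> 0\<close> \<open>0 \<le> g\<close> by (auto simp: t_def field_simps)
    have "t * (2 * (h \<bullet> h)) \<le> t * (t * g)"
      using quad[of t] by (simp add: power2_eq_square algebra_simps)
    then have "2 * (h \<bullet> h) \<le> t * g" using t(1) by simp
    with t \<open>\<not> h \<bullet> h \<le> 0\<close> show False by linarith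
  qed
  then have "h = 0" using inner_ge_zero[of h] by (simp add: inner_gt_zero_iff flip: not_le)
  then have "f e = l *\<^sub>R e" by (simp add: h_def)
  with e that show thesis by blast
qed

definition orthonormal_basis :: "'a::euclidean_space set \<Rightarrow> 'a set \<Rightarrow> bool" where
  "orthonormal_basis B S \<longleftrightarrow> finite B \<and> pairwise orthogonal B \<and> (\<forall>b\<in>B. norm b = 1) \<and> span B = S"

text \<open>Induction on the dimension: split off a unit eigenvector \<open>e\<close>; by
  self-adjointness its orthogonal complement in \<open>S\<close> is again invariant.\<close>

lemma selfadjoint_eigenbasis:
  fixes f :: "'a::euclidean_space \<Rightarrow> 'a"
  assumes lin: "linear f" and sa: "\<And>x y. f x \<bullet> y = x \<bullet> f y"
  shows "subspace S \<Longrightarrow> (\<And>x. x \<in> S \<Longrightarrow> f x \<in> S) \<Longrightarrow>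
    \<exists>B. orthonormal_basis B S \<and> (\<forall>b\<in>B. \<exists>l. f b = l *\<^sub>R b)"
proof (induction "dim S" arbitrary: S rule: less_induct)
  case less
  show ?case
  proof (cases "S = {0}")
    case True
    then show ?thesis by (intro exI[of _ "{}"]) (simp add: orthonormal_basis_def)
  next
    case False
    with selfadjoint_eigenvector[OF lin sa less.prems] obtain e l
      where e: "e \<in> S" "norm e = 1" "f e = l *\<^sub>R e" by metis
    define T where "T = {x \<in> S. e \<bullet> x = 0}"
    have T: "subspace T"
      using less.prems(1) unfolding T_def subspace_def by (auto simp: inner_simps)
    have fT: "f x \<in> T" if "x \<in> T" for x
      using that less.prems(2) sa[of e x] e by (auto simp: T_def)
    have "e \<notin> T" using e by (simp add: T_def flip: power2_norm_eq_inner)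
    moreover have "T \<subseteq> S" by (auto simp: T_def)
    ultimately have "T \<subset> S" using e(1) by blast
    then have "dim T < dim S"
      using T less.prems(1) by (metis dim_psubset span_eq_iff)
    from less.hyps[OF this T fT] obtain B
      where B: "orthonormal_basis B T" "\<forall>b\<in>B. \<exists>l. f b = l *\<^sub>R b" by blast
    have BT: "B \<subseteq> T" using B(1) span_superset by (auto simp: orthonormal_basis_def)
    have "span (insert e B) = S"
    proof
      show "span (insert e B) \<subseteq> S"
        using BT e less.prems(1) by (intro span_minimal) (auto simp: T_def)
      show "S \<subseteq> span (insert e B)"
      proof
        fix x assume "x \<in> S"
        then have "x - (e \<bullet> x) *\<^sub>R e \<in> T"
          using e(1,2) less.prems(1) unfolding T_def norm_eq_1
          by (simp add: inner_diff_right subspace_diff subspace_scale)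
        then have "x - (e \<bullet> x) *\<^sub>R e \<in> span B" using B(1) by (simp add: orthonormal_basis_def)
        then show "x \<in> span (insert e B)" by (auto simp: span_insert)
      qed
    qed
    moreover have "pairwise orthogonal (insert e B)"
      using B(1) BT by (auto simp: pairwise_insert orthonormal_basis_def T_def orthogonal_def inner_commute)
    ultimately have "orthonormal_basis (insert e B) S"
      using B(1) e by (auto simp: orthonormal_basis_def)
    with B(2) e(3) show ?thesis by blast
  qed
qed

lemma orthonormal_expand:
  assumes "orthonormal_basis B UNIV"
  shows "(\<Sum>b\<in>B. (x \<bullet> b) *\<^sub>R b) = x"
  using assms by (intro orthonormal_basis_expand) (auto simp: orthonormal_basis_def)

lemma orthonormal_inner:
  assumes "orthonormal_basis B UNIV"
  shows "(\<Sum>b\<in>B. (x \<bullet> b) * (y \<bullet> b)) = x \<bullet> y"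
proof -
  have "x \<bullet> y = (\<Sum>b\<in>B. (x \<bullet> b) *\<^sub>R b) \<bullet> y" using orthonormal_expand[OF assms] by simp
  then show ?thesis by (simp only: inner_sum_left inner_scaleR_left inner_commute[of y])
qed

lemma orthonormal_delta:
  assumes "orthonormal_basis B S" "b \<in> B" "b' \<in> B"
  shows "b \<bullet> b' = (if b = b' then 1 else 0)"
  using assms by (auto simp: orthonormal_basis_def pairwise_def orthogonal_def norm_eq_1)

section \<open>Eigenbases and traces of symmetric matrices\<close>

lemma sym_inner:
  assumes "M \<in> sym_mats"
  shows "(M *v x) \<bullet> y = x \<bullet> (M *v y)"
proof -
  have t: "transpose M = M" using assms by (simp add: sym_mats_def)
  have "M *v x = transpose M *v x" by (simp only: t)
  then show ?thesis by (simp add: dot_lmul_matrix)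
qed

lemma symmetric_eigenbasis:
  assumes "M \<in> sym_mats"
  obtains B l where "orthonormal_basis B UNIV" "\<And>b. b \<in> B \<Longrightarrow> M *v b = l b *\<^sub>R b"
proof -
  obtain B where B: "orthonormal_basis B UNIV" "\<forall>b\<in>B. \<exists>l. M *v b = l *\<^sub>R b"
    using selfadjoint_eigenbasis[of "(*v) M" UNIV] sym_inner[OF assms] by auto
  from B(2) obtain l where "\<forall>b\<in>B. M *v b = l b *\<^sub>R b" by metis
  with B(1) that show thesis by blast
qed

text \<open>Parseval for each axis vector and its image gives a double sum; summing over the axis
  vectors first leaves the diagonal of the transpose in the basis \<open>B\<close>, which is that of
  \<open>A\<close>.\<close>

lemma trace_orthonormal:
  fixes A :: "real^'n^'n"
  assumes "orthonormal_basis B UNIV"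
  shows "trace A = (\<Sum>b\<in>B. b \<bullet> (A *v b))"
proof -
  have "trace A = (\<Sum>i\<in>UNIV. (axis i 1) \<bullet> (A *v axis i 1))"
    by (simp add: trace_def inner_axis' matrix_vector_mult_basis column_def)
  also have "\<dots> = (\<Sum>i\<in>UNIV. \<Sum>b\<in>B. (axis i 1 \<bullet> b) * ((A *v axis i 1) \<bullet> b))"
    by (simp only: orthonormal_inner[OF assms])
  also have "\<dots> = (\<Sum>b\<in>B. \<Sum>i\<in>UNIV. b $ i * (axis i 1 \<bullet> (transpose A *v b)))"
    by (subst sum.swap) (simp add: inner_axis' inner_commute[of "A *v _"] inner_axis flip: dot_lmul_matrix)
  also have "\<dots> = (\<Sum>b\<in>B. b \<bullet> (transpose A *v b))"
    by (simp add: inner_axis') (simp add: inner_vec_def)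
  also have "\<dots> = (\<Sum>b\<in>B. b \<bullet> (A *v b))"
    by (simp add: inner_commute flip: dot_lmul_matrix)
  finally show ?thesis .
qed

section \<open>Rank-one matrices and closure properties of the symmetric matrices\<close>

definition outer :: "real^'n \<Rightarrow> real^'n^'n" where
  "outer x = (\<chi> i j. x $ i * x $ j)"

lemma outer_mult: "outer x *v y = (x \<bullet> y) *\<^sub>R x"
  by (simp add: outer_def matrix_vector_mult_def vec_eq_iff inner_vec_def sum_distrib_left
      sum_distrib_right mult_ac)

lemma outer_sym: "outer x \<in> sym_mats"
  by (simp add: outer_def sym_mats_def transpose_def mult.commute)

lemma trace_outer: "trace (outer x) = x \<bullet> x"
  by (simp add: outer_def trace_def inner_vec_def)

lemma sym_mats_add: "A \<in> sym_mats \<Longrightarrow> B \<in> sym_mats \<Longrightarrow> A + B \<in> sym_mats"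
  and sym_mats_diff: "A \<in> sym_mats \<Longrightarrow> B \<in> sym_mats \<Longrightarrow> A - B \<in> sym_mats"
  and sym_mats_scale: "A \<in> sym_mats \<Longrightarrow> c *\<^sub>R A \<in> sym_mats"
  and sym_mats_uminus: "A \<in> sym_mats \<Longrightarrow> - A \<in> sym_mats"
  and sym_mats_0: "0 \<in> sym_mats"
  and sym_mats_1: "mat 1 \<in> sym_mats"
  by (auto simp: sym_mats_def transpose_def vec_eq_iff mat_def)

lemma sym_mats_sum: "(\<And>b. b \<in> B \<Longrightarrow> A b \<in> sym_mats) \<Longrightarrow> sum A B \<in> sym_mats"
  by (induction B rule: infinite_finite_induct) (auto intro: sym_mats_add sym_mats_0)

lemma sum_matrix_vector: "sum A B *v x = (\<Sum>b\<in>B. A b *v x)" for A :: "'b \<Rightarrow> real^'n^'m"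
  by (induction B rule: infinite_finite_induct) (auto simp: matrix_vector_mult_add_rdistrib)

lemma matrix_eq_on_span:
  fixes A A' :: "real^'n^'n"
  assumes "span B = UNIV" "\<And>b. b \<in> B \<Longrightarrow> A *v b = A' *v b"
  shows "A = A'"
proof -
  have "A *v x = A' *v x" for x
    by (rule linear_eq_on_span[of "(*v) A" "(*v) A'" B]) (simp_all add: assms)
  then show ?thesis by (simp add: matrix_eq)
qed

text \<open>In an eigenbasis of \<open>M\<close>, clip the eigenvalues: their positive parts give
  \<open>P\<close>, their negative parts \<open>Q\<close>.\<close>

lemma pos_neg_decomp_exists:
  fixes M :: "real^'n^'n"
  assumes "M \<in> sym_mats"
  shows "\<exists>P Q. pos_neg_decomp M P Q"
proof -
  obtain B l where B: "orthonormal_basis B UNIV" and l: "\<And>b. b \<in> B \<Longrightarrow> M *v b = l b *\<^sub>R b"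
    using symmetric_eigenbasis[OF assms] by blast
  have fin: "finite B" using B by (simp add: orthonormal_basis_def)
  \<comment> \<open>\<open>D k\<close> is diagonal in \<open>B\<close> with eigenvalues
    \<open>k b\<close>.\<close>
  define D where "D k = (\<Sum>b\<in>B. k b *\<^sub>R outer b)" for k
  have Dx: "D k *v x = (\<Sum>b\<in>B. (k b * (b \<bullet> x)) *\<^sub>R b)" for k x
    by (simp add: D_def sum_matrix_vector outer_mult flip: scaleR_matrix_vector_assoc)
  have Db: "D k *v b = k b *\<^sub>R b" if "b \<in> B" for k b
  proof -
    have "D k *v b = (\<Sum>b'\<in>B. if b' = b then k b *\<^sub>R b else 0)"
      unfolding Dx by (rule sum.cong) (auto simp: orthonormal_delta[OF B _ that])
    then show ?thesis using that fin by simp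
  qed
  have psd: "psd (D k)" if "\<And>b. k b \<ge> 0" for k
    unfolding psd_def
  proof (intro conjI allI)
    show "D k \<in> sym_mats" unfolding D_def by (intro sym_mats_sum sym_mats_scale outer_sym)
    show "0 \<le> x \<bullet> (D k *v x)" for x
      unfolding Dx inner_sum_right by (intro sum_nonneg) (simp add: that inner_commute mult.assoc)
  qed
  let ?P = "D (\<lambda>b. max (l b) 0)" and ?Q = "D (\<lambda>b. max (- l b) 0)"
  have sp: "span B = UNIV" using B by (simp add: orthonormal_basis_def)
  have "?P ** ?Q = 0"
    by (rule matrix_eq_on_span[OF sp])
      (auto simp: Db matrix_vector_mult_scaleR max_def simp flip: matrix_vector_mul_assoc)
  moreover have "M = ?P - ?Q"
    by (rule matrix_eq_on_span[OF sp])
      (auto simp: Db l matrix_vector_mult_diff_rdistrib max_def)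
  ultimately show ?thesis using psd unfolding pos_neg_decomp_def by (metis max.cobounded2)
qed

section \<open>Uniqueness of the positive and negative parts\<close>

lemma pos_neg_decomp_sym: "pos_neg_decomp M P Q \<Longrightarrow> M \<in> sym_mats"
  by (auto simp: pos_neg_decomp_def psd_def intro: sym_mats_diff)

lemma pos_neg_decomp_uminus: "pos_neg_decomp M P Q \<Longrightarrow> pos_neg_decomp (- M) Q P"
proof -
  assume d: "pos_neg_decomp M P Q"
  then have "transpose (P ** Q) = 0" by (simp add: pos_neg_decomp_def transpose_def vec_eq_iff)
  then have "Q ** P = 0"
    using d by (simp add: matrix_transpose_mul pos_neg_decomp_def psd_def sym_mats_def)
  with d show ?thesis by (simp add: pos_neg_decomp_def)
qed

text \<open>As \<open>P ** Q\<close> and \<open>Q ** P\<close> vanish, applying \<open>P\<close> and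
  \<open>Q\<close> to \<open>P e - Q e = l e\<close> shows that \<open>P\<close> multiplies
  \<open>P e\<close> by \<open>l\<close> and \<open>Q\<close> multiplies \<open>Q e\<close> by
  \<open>- l\<close>. Semidefiniteness kills the vector with the negative factor; for
  \<open>l = 0\<close> symmetry gives \<open>|P e|^2 = 0\<close>. Thus \<open>M\<close> determines
  \<open>P\<close> on an eigenbasis, whence uniqueness.\<close>

lemma pos_neg_decomp_eigenvector:
  fixes M :: "real^'n^'n"
  assumes d: "pos_neg_decomp M P Q" and e: "M *v e = l *\<^sub>R e"
  shows "P *v e = max l 0 *\<^sub>R e"
proof -
  have P: "psd P" "psd Q" "P ** Q = 0" "M = P - Q"
    using d by (auto simp: pos_neg_decomp_def)
  have Q: "Q ** P = 0"
    using pos_neg_decomp_uminus[OF d] by (simp add: pos_neg_decomp_def)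
  have "P *v (Q *v e) = 0" "Q *v (P *v e) = 0"
    by (simp_all add: matrix_vector_mul_assoc P Q)
  moreover have eq: "P *v e - Q *v e = l *\<^sub>R e"
    using e P by (simp add: matrix_vector_mult_diff_rdistrib)
  then have "P *v (P *v e - Q *v e) = l *\<^sub>R (P *v e)" "Q *v (P *v e - Q *v e) = l *\<^sub>R (Q *v e)"
    by (simp_all add: matrix_vector_mult_scaleR)
  ultimately have PP: "P *v (P *v e) = l *\<^sub>R (P *v e)" and QQ: "Q *v (Q *v e) = (- l) *\<^sub>R (Q *v e)"
    by (simp_all add: matrix_vector_mult_diff_distrib) (metis minus_minus)
  have *: "w = 0" if "psd A" "A *v w = k *\<^sub>R w" "k < 0" for A :: "real^'n^'n" and w k
  proof -
    have "0 \<le> k * (w \<bullet> w)" using that(1,2) unfolding psd_def by (metis inner_scaleR_right)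
    with \<open>k < 0\<close> have "w \<bullet> w \<le> 0" by (simp add: zero_le_mult_iff)
    then show ?thesis by (metis inner_eq_zero_iff inner_ge_zero order_antisym)
  qed
  consider "l < 0" | "l > 0" | "l = 0" by linarith
  then show ?thesis
  proof cases
    case 1
    then show ?thesis using *[OF P(1) PP] by simp
  next
    case 2
    then have "Q *v e = 0" using *[OF P(2) QQ] by simp
    with eq 2 show ?thesis by simp
  next
    case 3
    have "(P *v e) \<bullet> (P *v e) = e \<bullet> (P *v (P *v e))"
      using P(1) sym_inner unfolding psd_def by blast
    then show ?thesis using PP 3 by simp
  qed
qed

lemma pos_neg_decomp_unique:
  fixes M :: "real^'n^'n"
  assumes "pos_neg_decomp M P Q" "pos_neg_decomp M P' Q'"
  shows "P = P'" "Q = Q'"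
proof -
  obtain B l where B: "orthonormal_basis B UNIV" and l: "\<And>b. b \<in> B \<Longrightarrow> M *v b = l b *\<^sub>R b"
    using symmetric_eigenbasis[OF pos_neg_decomp_sym[OF assms(1)]] by blast
  show "P = P'"
  proof (rule matrix_eq_on_span)
    show "span B = UNIV" using B by (simp add: orthonormal_basis_def)
    show "P *v b = P' *v b" if "b \<in> B" for b
      using assms[THEN pos_neg_decomp_eigenvector, OF l[OF that]] by simp
  qed
  then show "Q = Q'" using assms by (auto simp: pos_neg_decomp_def)
qed

lemma mat_parts_eq:
  assumes "pos_neg_decomp M P Q"
  shows "mat_pos_part M = P" "mat_neg_part M = Q"
proof -
  show "mat_pos_part M = P"
    unfolding mat_pos_part_def
    by (rule the_equality) (use assms pos_neg_decomp_unique(1)[OF _ assms] in blast)+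
  show "mat_neg_part M = Q"
    unfolding mat_neg_part_def
    by (rule the_equality) (use assms pos_neg_decomp_unique(2)[OF _ assms] in blast)+
qed

lemma pos_neg_decomp_parts:
  assumes "M \<in> sym_mats"
  shows "pos_neg_decomp M (mat_pos_part M) (mat_neg_part M)"
proof -
  obtain P Q where d: "pos_neg_decomp M P Q" using pos_neg_decomp_exists[OF assms] by blast
  then show ?thesis by (simp only: mat_parts_eq[OF d])
qed

text \<open>The trace of the positive part is the least trace of a positive semidefinite matrix above \<open>M\<close>,
  whence the monotonicity of Pucci's operators.\<close>

lemma trace_mat_pos_part_le:
  fixes M X :: "real^'n^'n"
  assumes M: "M \<in> sym_mats" and X: "psd X" "psd (X - M)"
  shows "trace (mat_pos_part M) \<le> trace X"
proof -
  obtain B l where B: "orthonormal_basis B UNIV" and l: "\<And>b. b \<in> B \<Longrightarrow> M *v b = l b *\<^sub>R b"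
    using symmetric_eigenbasis[OF M] by blast
  have "b \<bullet> (mat_pos_part M *v b) \<le> b \<bullet> (X *v b)" if "b \<in> B" for b
  proof -
    have b: "b \<bullet> b = 1" using orthonormal_delta[OF B that that] by simp
    have "b \<bullet> (mat_pos_part M *v b) = max (l b) 0"
      using pos_neg_decomp_eigenvector[OF pos_neg_decomp_parts[OF M] l[OF that]] b by simp
    moreover have "0 \<le> b \<bullet> (X *v b)" "0 \<le> b \<bullet> (X *v b) - l b"
      using X spec[of "\<lambda>x. 0 \<le> x \<bullet> ((X - M) *v x)" b] l[OF that] b
      by (auto simp: psd_def matrix_vector_mult_diff_rdistrib inner_diff_right)
    ultimately show ?thesis by simp
  qed
  then show ?thesis unfolding trace_orthonormal[OF B] by (rule sum_mono)
qed

section \<open>Pucci operators\<close>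

text \<open>One family for both operators, which differ by exchanging the two constants. No order
  between \<open>c\<close> and \<open>d\<close> is imposed, so every estimate below serves
  both.\<close>

definition pucci :: "real \<Rightarrow> real \<Rightarrow> real^'n^'n \<Rightarrow> real" where
  "pucci c d M = c * trace (mat_pos_part M) - d * trace (mat_neg_part M)"

lemma pucci_plus_eq: "pucci_plus lam Lam = pucci Lam lam"
  and pucci_minus_eq: "pucci_minus lam Lam = pucci lam Lam"
  by (simp_all add: fun_eq_iff pucci_plus_def pucci_minus_def pucci_def)

lemma pucci_decomp:
  assumes "pos_neg_decomp M P Q"
  shows "pucci c d M = c * trace P - d * trace Q"
  by (simp only: pucci_def mat_parts_eq[OF assms])

lemma psd_add: "psd A \<Longrightarrow> psd B \<Longrightarrow> psd (A + B)"
  by (auto simp: psd_def matrix_vector_mult_add_rdistrib inner_add_right intro: sym_mats_add)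

lemma sym_mats_of_psd_diff:
  assumes "M \<in> sym_mats" "psd (M' - M)"
  shows "M' \<in> sym_mats"
proof -
  have "M + (M' - M) \<in> sym_mats"
    using assms by (intro sym_mats_add) (simp_all add: psd_def)
  then show ?thesis by simp
qed

text \<open>The positive part of \<open>M'\<close> exceeds \<open>M\<close> by the negative part of
  \<open>M'\<close> plus \<open>M' - M\<close>, so it is a competitor in
  \<open>trace_mat_pos_part_le\<close>.\<close>

lemma trace_mat_pos_part_mono:
  fixes M M' :: "real^'n^'n"
  assumes "M \<in> sym_mats" "psd (M' - M)"
  shows "trace (mat_pos_part M) \<le> trace (mat_pos_part M')"
proof -
  have M': "M' \<in> sym_mats"
    using assms by (rule sym_mats_of_psd_diff)
  note d = pos_neg_decomp_parts[OF M', unfolded pos_neg_decomp_def]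
  have "psd (mat_pos_part M' - M)"
  proof -
    have "mat_pos_part M' - M = mat_neg_part M' + (M' - M)"
      using d by (simp add: algebra_simps)
    then show ?thesis using d assms(2) psd_add by metis
  qed
  then show ?thesis using assms(1) d by (intro trace_mat_pos_part_le) auto
qed

text \<open>The negative part of \<open>M\<close> is the positive part of \<open>- M\<close>, so its
  trace decreases as \<open>M\<close> grows.\<close>

lemma pucci_mono:
  fixes M M' :: "real^'n^'n"
  assumes M: "M \<in> sym_mats" and le: "psd (M' - M)" and cd: "0 \<le> c" "0 \<le> d"
  shows "pucci c d M \<le> pucci c d M'"
proof -
  have M': "M' \<in> sym_mats"
    using M le by (rule sym_mats_of_psd_diff)
  have tr: "trace A = trace (mat_pos_part A) - trace (mat_neg_part A)" if "A \<in> sym_mats" for A :: "real^'n^'n"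
    using pos_neg_decomp_parts[OF that] by (metis pos_neg_decomp_def trace_sub)
  have neg: "mat_neg_part A = mat_pos_part (- A)" if "A \<in> sym_mats" for A :: "real^'n^'n"
    using mat_parts_eq(1)[OF pos_neg_decomp_uminus[OF pos_neg_decomp_parts[OF that]]] by simp
  have 1: "trace (mat_pos_part M) \<le> trace (mat_pos_part M')"
    using M le by (rule trace_mat_pos_part_mono)
  have 2: "trace (mat_neg_part M') \<le> trace (mat_neg_part M)"
    unfolding neg[OF M] neg[OF M'] using M' le
    by (intro trace_mat_pos_part_mono sym_mats_uminus) auto
  from 1 2 cd show ?thesis unfolding pucci_def
    by (intro diff_mono mult_left_mono)
qed

section \<open>Hessians\<close>

lemma C2_line_derivs:
  fixes \<phi> :: "real^'n \<Rightarrow> real"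
  assumes "\<forall>x\<in>U. (\<phi> has_derivative (\<lambda>h. g x \<bullet> h)) (at x) \<and> (g has_derivative (\<lambda>h. H x *v h)) (at x)"
    and "y + s *\<^sub>R h \<in> U"
  shows "((\<lambda>s. \<phi> (y + s *\<^sub>R h)) has_real_derivative g (y + s *\<^sub>R h) \<bullet> h) (at s)"
    and "((\<lambda>s. g (y + s *\<^sub>R h) \<bullet> k) has_real_derivative k \<bullet> (H (y + s *\<^sub>R h) *v h)) (at s)"
proof -
  have l: "((\<lambda>s. y + s *\<^sub>R h) has_derivative (\<lambda>t. t *\<^sub>R h)) (at s)"
    by (auto intro!: derivative_eq_intros)
  have "((\<lambda>s. \<phi> (y + s *\<^sub>R h)) has_derivative (\<lambda>t. g (y + s *\<^sub>R h) \<bullet> (t *\<^sub>R h))) (at s)"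
    using has_derivative_compose[OF l, of \<phi>] assms by blast
  then show "((\<lambda>s. \<phi> (y + s *\<^sub>R h)) has_real_derivative g (y + s *\<^sub>R h) \<bullet> h) (at s)"
    by (simp add: has_field_derivative_def mult.commute[of _ "_ \<bullet> _"] fun_eq_iff)
  have "((\<lambda>s. g (y + s *\<^sub>R h)) has_derivative (\<lambda>t. H (y + s *\<^sub>R h) *v (t *\<^sub>R h))) (at s)"
    using has_derivative_compose[OF l, of g] assms by blast
  then have "((\<lambda>s. g (y + s *\<^sub>R h) \<bullet> k) has_derivative (\<lambda>t. (H (y + s *\<^sub>R h) *v (t *\<^sub>R h)) \<bullet> k)) (at s)"
    by (rule has_derivative_inner_left)
  then show "((\<lambda>s. g (y + s *\<^sub>R h) \<bullet> k) has_real_derivative k \<bullet> (H (y + s *\<^sub>R h) *v h)) (at s)"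
    by (simp add: has_field_derivative_def matrix_vector_mult_scaleR inner_commute
        mult.commute[of _ "k \<bullet> _"])
qed

text \<open>The mean value theorem along \<open>h\<close> turns the second difference into a
  difference of \<open>g \<bullet> h\<close>; along \<open>k\<close> it turns that into one value of
  the Hessian.\<close>

lemma second_difference_mvt:
  fixes \<phi> :: "real^'n \<Rightarrow> real"
  assumes C: "\<forall>x\<in>U. (\<phi> has_derivative (\<lambda>h. g x \<bullet> h)) (at x) \<and> (g has_derivative (\<lambda>h. H x *v h)) (at x)"
    and U: "\<And>s t. 0 \<le> s \<Longrightarrow> s \<le> 1 \<Longrightarrow> 0 \<le> t \<Longrightarrow> t \<le> 1 \<Longrightarrow> x + s *\<^sub>R h + t *\<^sub>R k \<in> U"
  obtains s t where "0 \<le> s" "s \<le> 1" "0 \<le> t" "t \<le> 1"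
    "\<phi> (x + h + k) - \<phi> (x + h) - \<phi> (x + k) + \<phi> x = h \<bullet> (H (x + s *\<^sub>R h + t *\<^sub>R k) *v k)"
proof -
  let ?D = "\<lambda>s. \<phi> (x + k + s *\<^sub>R h) - \<phi> (x + s *\<^sub>R h)"
  have "\<exists>s>0. s < 1 \<and> ?D 1 - ?D 0 = (1 - 0) * (g (x + k + s *\<^sub>R h) \<bullet> h - g (x + s *\<^sub>R h) \<bullet> h)"
  proof (rule MVT2[where f = ?D and f' = "\<lambda>s. g (x + k + s *\<^sub>R h) \<bullet> h - g (x + s *\<^sub>R h) \<bullet> h"])
    fix s :: real assume s: "0 \<le> s" "s \<le> 1"
    have "x + k + s *\<^sub>R h \<in> U" "x + s *\<^sub>R h \<in> U"
      using U[OF s, of 1] U[OF s, of 0] by (simp_all add: ac_simps)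
    then show "(?D has_real_derivative (g (x + k + s *\<^sub>R h) \<bullet> h - g (x + s *\<^sub>R h) \<bullet> h)) (at s)"
      by (intro DERIV_diff C2_line_derivs(1)[OF C])
  qed simp
  then obtain s where s: "0 < s" "s < 1"
    and 1: "?D 1 - ?D 0 = g (x + k + s *\<^sub>R h) \<bullet> h - g (x + s *\<^sub>R h) \<bullet> h" by auto
  let ?G = "\<lambda>t. g (x + s *\<^sub>R h + t *\<^sub>R k) \<bullet> h"
  have "\<exists>t>0. t < 1 \<and> ?G 1 - ?G 0 = (1 - 0) * (h \<bullet> (H (x + s *\<^sub>R h + t *\<^sub>R k) *v k))"
    by (rule MVT2[where f = ?G and f' = "\<lambda>t. h \<bullet> (H (x + s *\<^sub>R h + t *\<^sub>R k) *v k)"])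
      (use s U in \<open>auto intro!: C2_line_derivs(2)[OF C]\<close>)
  then obtain t where t: "0 < t" "t < 1"
    and 2: "?G 1 - ?G 0 = h \<bullet> (H (x + s *\<^sub>R h + t *\<^sub>R k) *v k)" by auto
  show thesis
    by (rule that[of s t]) (use s t 1 2 in \<open>simp_all add: algebra_simps\<close>)
qed

text \<open>Schwarz's theorem: the second difference is symmetric in \<open>h\<close> and \<open>k\<close>.\<close>

lemma C2_hessian_sym:
  assumes "C2_with_hessian U \<phi> H" "x \<in> U"
  shows "H x \<in> sym_mats"
proof -
  obtain g where C: "\<forall>x\<in>U. (\<phi> has_derivative (\<lambda>h. g x \<bullet> h)) (at x) \<and> (g has_derivative (\<lambda>h. H x *v h)) (at x)"
    and U: "open U" and cont: "continuous_on U H"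
    using assms(1) by (auto simp: C2_with_hessian_def)
  have "h \<bullet> (H x *v k) = k \<bullet> (H x *v h)" for h k
  proof (rule ccontr)
    \<comment> \<open>Half the gap: a number strictly within \<open>e\<close> of both sides cannot
      exist.\<close>
    define e where "e = \<bar>h \<bullet> (H x *v k) - k \<bullet> (H x *v h)\<bar> / 2"
    assume "h \<bullet> (H x *v k) \<noteq> k \<bullet> (H x *v h)"
    then have e: "e > 0" by (simp add: e_def)
    have isc: "isCont H x" using cont U assms(2) continuous_on_eq_continuous_at by blast
    have near: "\<forall>\<^sub>F y in nhds x. \<bar>a \<bullet> (H y *v b) - a \<bullet> (H x *v b)\<bar> < e" for a b
    proof -
      have "isCont (\<lambda>y. a \<bullet> (H y *v b)) x"
        unfolding inner_vec_def matrix_vector_mult_def using isc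
        by (auto intro!: continuous_intros)
      then have "((\<lambda>y. a \<bullet> (H y *v b)) \<longlongrightarrow> a \<bullet> (H x *v b)) (nhds x)"
        using tendsto_at_iff_tendsto_nhds[of "\<lambda>y. a \<bullet> (H y *v b)" x] by (simp add: isCont_def)
      from tendstoD[OF this e] show ?thesis by (simp add: dist_real_def)
    qed
    have "\<forall>\<^sub>F y in nhds x. y \<in> U \<and> \<bar>h \<bullet> (H y *v k) - h \<bullet> (H x *v k)\<bar> < e \<and> \<bar>k \<bullet> (H y *v h) - k \<bullet> (H x *v h)\<bar> < e"
      using near U assms(2) by (intro eventually_conj eventually_nhds_in_open) auto
    then obtain r where r: "r > 0" and ball: "\<And>y. dist y x < r \<Longrightarrow>
        y \<in> U \<and> \<bar>h \<bullet> (H y *v k) - h \<bullet> (H x *v k)\<bar> < e \<and> \<bar>k \<bullet> (H y *v h) - k \<bullet> (H x *v h)\<bar> < e"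
      by (auto simp: eventually_nhds_metric)
    \<comment> \<open>Scaling \<open>h\<close> and \<open>k\<close> by \<open>m\<close> puts the
      whole parallelogram into the ball of radius \<open>r\<close>; the factor \<open>m^2\<close>
      cancels at the end.\<close>
    define m where "m = r / (norm h + norm k + 1)"
    have pos: "0 < norm h + norm k + 1" by (simp add: add_nonneg_pos)
    then have m: "m > 0" using r by (simp add: m_def)
    have "m * (norm h + norm k) < r"
    proof -
      have "m * (norm h + norm k + 1) = r" using pos by (simp add: m_def)
      with m show ?thesis by (simp add: algebra_simps)
    qed
    have in_ball: "dist (x + s *\<^sub>R (m *\<^sub>R h) + t *\<^sub>R (m *\<^sub>R k)) x < r"
      if "0 \<le> s" "s \<le> 1" "0 \<le> t" "t \<le> 1" for s t
    proof -
      have "norm (s *\<^sub>R (m *\<^sub>R h) + t *\<^sub>R (m *\<^sub>R k)) \<le> norm (s *\<^sub>R (m *\<^sub>R h)) + norm (t *\<^sub>R (m *\<^sub>R k))"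
        by (rule norm_triangle_ineq)
      also have "\<dots> \<le> m * norm h + m * norm k"
        using that m by (intro add_mono) (auto simp: mult_left_le_one_le)
      also have "\<dots> < r" using \<open>m * (norm h + norm k) < r\<close> by (simp add: algebra_simps)
      finally show ?thesis by (simp add: dist_norm add.assoc)
    qed
    have in_ball': "dist (x + s *\<^sub>R (m *\<^sub>R k) + t *\<^sub>R (m *\<^sub>R h)) x < r"
      if "0 \<le> s" "s \<le> 1" "0 \<le> t" "t \<le> 1" for s t
      using in_ball[OF that(3,4,1,2)] by (simp add: algebra_simps)
    obtain s t where st: "0 \<le> s" "s \<le> 1" "0 \<le> t" "t \<le> 1"
      and 1: "\<phi> (x + m *\<^sub>R h + m *\<^sub>R k) - \<phi> (x + m *\<^sub>R h) - \<phi> (x + m *\<^sub>R k) + \<phi> x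
        = (m *\<^sub>R h) \<bullet> (H (x + s *\<^sub>R (m *\<^sub>R h) + t *\<^sub>R (m *\<^sub>R k)) *v (m *\<^sub>R k))"
      by (rule second_difference_mvt[OF C, of x "m *\<^sub>R h" "m *\<^sub>R k"]) (use in_ball ball in blast)
    obtain s' t' where st': "0 \<le> s'" "s' \<le> 1" "0 \<le> t'" "t' \<le> 1"
      and 2: "\<phi> (x + m *\<^sub>R k + m *\<^sub>R h) - \<phi> (x + m *\<^sub>R k) - \<phi> (x + m *\<^sub>R h) + \<phi> x
        = (m *\<^sub>R k) \<bullet> (H (x + s' *\<^sub>R (m *\<^sub>R k) + t' *\<^sub>R (m *\<^sub>R h)) *v (m *\<^sub>R h))"
      by (rule second_difference_mvt[OF C, of x "m *\<^sub>R k" "m *\<^sub>R h"]) (use in_ball' ball in blast)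
    define y z where "y = x + s *\<^sub>R (m *\<^sub>R h) + t *\<^sub>R (m *\<^sub>R k)"
      and "z = x + s' *\<^sub>R (m *\<^sub>R k) + t' *\<^sub>R (m *\<^sub>R h)"
    have "(m *\<^sub>R h) \<bullet> (H y *v (m *\<^sub>R k)) = (m *\<^sub>R k) \<bullet> (H z *v (m *\<^sub>R h))"
    proof -
      have "x + m *\<^sub>R k + m *\<^sub>R h = x + m *\<^sub>R h + m *\<^sub>R k" by (simp add: ac_simps)
      from 1 2[unfolded this] show ?thesis unfolding y_def z_def by linarith
    qed
    then have "h \<bullet> (H y *v k) = k \<bullet> (H z *v h)"
      using m by (simp add: matrix_vector_mult_scaleR)
    moreover have "\<bar>h \<bullet> (H y *v k) - h \<bullet> (H x *v k)\<bar> < e" "\<bar>k \<bullet> (H z *v h) - k \<bullet> (H x *v h)\<bar> < e"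
      using ball in_ball[OF st] in_ball'[OF st'] by (auto simp: y_def z_def)
    ultimately show False unfolding e_def by (simp add: abs_if split: if_splits)
  qed
  from this[of "axis _ 1" "axis _ 1"] show ?thesis
    by (simp add: sym_mats_def transpose_def vec_eq_iff inner_axis' matrix_vector_mult_basis column_def)
qed

lemma C2_with_hessian_diff:
  assumes "C2_with_hessian U \<phi> H" "C2_with_hessian U \<psi> K"
  shows "C2_with_hessian U (\<lambda>x. \<phi> x - \<psi> x) (\<lambda>x. H x - K x)"
proof -
  obtain g where g: "\<forall>x\<in>U. (\<phi> has_derivative (\<lambda>h. g x \<bullet> h)) (at x) \<and> (g has_derivative (\<lambda>h. H x *v h)) (at x)"
    using assms(1) by (auto simp: C2_with_hessian_def)
  obtain k where k: "\<forall>x\<in>U. (\<psi> has_derivative (\<lambda>h. k x \<bullet> h)) (at x) \<and> (k has_derivative (\<lambda>h. K x *v h)) (at x)"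
    using assms(2) by (auto simp: C2_with_hessian_def)
  have "\<forall>x\<in>U. ((\<lambda>x. \<phi> x - \<psi> x) has_derivative (\<lambda>h. (g x - k x) \<bullet> h)) (at x) \<and>
      ((\<lambda>x. g x - k x) has_derivative (\<lambda>h. (H x - K x) *v h)) (at x)"
    unfolding inner_diff_left matrix_vector_mult_diff_rdistrib using g k
    by (auto intro!: has_derivative_diff)
  then show ?thesis
    using assms unfolding C2_with_hessian_def by (auto intro!: continuous_on_diff)
qed

lemma C2_with_hessian_subset:
  "C2_with_hessian V \<phi> H \<Longrightarrow> open U \<Longrightarrow> U \<subseteq> V \<Longrightarrow> C2_with_hessian U \<phi> H"
  unfolding C2_with_hessian_def by (blast intro: continuous_on_subset)

text \<open>Second-derivative test on lines through \<open>x\<close>: if the second derivative along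
  \<open>h\<close> were negative, the slope, which is zero at the minimum, would be negative just
  after it, and the mean value theorem would produce a smaller value.\<close>

lemma hessian_psd_at_min:
  assumes C2: "C2_with_hessian U \<phi> H" and x: "x \<in> U" and min: "\<And>y. y \<in> U \<Longrightarrow> \<phi> x \<le> \<phi> y"
  shows "psd (H x)"
  unfolding psd_def
proof (intro conjI allI)
  show "H x \<in> sym_mats" using C2 x by (rule C2_hessian_sym)
  fix h
  obtain g where C: "\<forall>x\<in>U. (\<phi> has_derivative (\<lambda>h. g x \<bullet> h)) (at x) \<and> (g has_derivative (\<lambda>h. H x *v h)) (at x)"
    and U: "open U"
    using C2 by (auto simp: C2_with_hessian_def)
  have "open ((\<lambda>s. x + s *\<^sub>R h) -` U)" using U by (intro continuous_intros open_vimage)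
  then obtain r where r: "r > 0" and rU: "\<And>s. \<bar>s\<bar> < r \<Longrightarrow> x + s *\<^sub>R h \<in> U"
    using x openE[of "(\<lambda>s. x + s *\<^sub>R h) -` U" 0] by (auto simp: ball_def subset_iff)
  show "0 \<le> h \<bullet> (H x *v h)"
  proof (rule ccontr)
    assume neg: "\<not> 0 \<le> h \<bullet> (H x *v h)"
    have "g x \<bullet> h = 0"
      using C2_line_derivs(1)[OF C, of x 0 h] r rU min x
      by (intro DERIV_local_min[of "\<lambda>s. \<phi> (x + s *\<^sub>R h)" _ 0 r]) auto
    moreover have "((\<lambda>s. g (x + s *\<^sub>R h) \<bullet> h) has_real_derivative h \<bullet> (H x *v h)) (at 0)"
      using C2_line_derivs(2)[OF C, of x 0 h h] x by simp
    from DERIV_neg_dec_right[OF this] neg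
    obtain d where d: "d > 0" "\<And>s. 0 < s \<Longrightarrow> s < d \<Longrightarrow> g (x + s *\<^sub>R h) \<bullet> h < g x \<bullet> h"
      by auto
    define t where "t = min d r / 2"
    have t: "0 < t" "t < d" "t < r" using d r by (auto simp: t_def)
    have "\<exists>s>0. s < t \<and> \<phi> (x + t *\<^sub>R h) - \<phi> (x + 0 *\<^sub>R h) = (t - 0) * (g (x + s *\<^sub>R h) \<bullet> h)"
      by (rule MVT2[where f = "\<lambda>s. \<phi> (x + s *\<^sub>R h)" and f' = "\<lambda>s. g (x + s *\<^sub>R h) \<bullet> h"])
        (use t rU in \<open>auto intro!: C2_line_derivs(1)[OF C]\<close>)
    then obtain s where "0 < s" "s < t" "\<phi> (x + t *\<^sub>R h) - \<phi> x = t * (g (x + s *\<^sub>R h) \<bullet> h)" by auto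
    moreover have "\<phi> x \<le> \<phi> (x + t *\<^sub>R h)" using t by (intro min rU) auto
    ultimately show False using d(2)[of s] t mult_pos_neg[of t "g (x + s *\<^sub>R h) \<bullet> h"] by linarith
  qed
qed

text \<open>Where \<open>\<phi>\<close> touches \<open>u\<close> from below,
  \<open>u - \<phi>\<close> has a local minimum, so its Hessian is positive semidefinite there, and
  \<open>pucci_mono\<close> passes the inequality from the Hessian of \<open>u\<close> to that of
  \<open>\<phi>\<close>.\<close>

lemma visc_supersol_classical:
  fixes \<Omega> :: "(real^'n) set"
  assumes C2: "C2_with_hessian \<Omega> u K" and cd: "0 \<le> c" "0 \<le> d"
    and le: "\<And>x. x \<in> \<Omega> \<Longrightarrow> pucci c d (K x) + \<mu> * f x * u x \<le> 0"
    and cont: "continuous_on \<Omega> u"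
  shows "visc_supersol (pucci c d) \<mu> f \<Omega> u"
  unfolding visc_supersol_def
proof (intro conjI ballI allI impI cont)
  fix x0 U \<phi> and H :: "real^'n \<Rightarrow> real^'n^'n"
  assume x0: "x0 \<in> \<Omega>" "x0 \<in> U" "U \<subseteq> \<Omega>" and \<phi>: "C2_with_hessian U \<phi> H"
    and min: "\<forall>x\<in>U. u x0 - \<phi> x0 \<le> u x - \<phi> x"
  have "open U" using \<phi> by (simp add: C2_with_hessian_def)
  then have "C2_with_hessian U (\<lambda>x. u x - \<phi> x) (\<lambda>x. K x - H x)"
    using C2_with_hessian_diff C2_with_hessian_subset C2 \<phi> x0(3) by blast
  then have "psd (K x0 - H x0)" using x0(2) min by (intro hessian_psd_at_min) auto
  then have "pucci c d (H x0) \<le> pucci c d (K x0)"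
    using C2_hessian_sym[OF \<phi> x0(2)] cd by (intro pucci_mono)
  with le[OF x0(1)] show "pucci c d (H x0) + \<mu> * f x0 * u x0 \<le> 0" by linarith
qed

lemma visc_subsol_classical:
  fixes \<Omega> :: "(real^'n) set"
  assumes C2: "C2_with_hessian \<Omega> u K" and cd: "0 \<le> c" "0 \<le> d"
    and ge: "\<And>x. x \<in> \<Omega> \<Longrightarrow> 0 \<le> pucci c d (K x) + \<mu> * f x * u x"
    and cont: "continuous_on \<Omega> u"
  shows "visc_subsol (pucci c d) \<mu> f \<Omega> u"
  unfolding visc_subsol_def
proof (intro conjI ballI allI impI cont)
  fix x0 U \<phi> and H :: "real^'n \<Rightarrow> real^'n^'n"
  assume x0: "x0 \<in> \<Omega>" "x0 \<in> U" "U \<subseteq> \<Omega>" and \<phi>: "C2_with_hessian U \<phi> H"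
    and max: "\<forall>x\<in>U. u x - \<phi> x \<le> u x0 - \<phi> x0"
  have "open U" using \<phi> by (simp add: C2_with_hessian_def)
  then have U: "C2_with_hessian U u K" using C2_with_hessian_subset C2 x0(3) by blast
  have "C2_with_hessian U (\<lambda>x. \<phi> x - u x) (\<lambda>x. H x - K x)"
    using C2_with_hessian_diff \<phi> U by blast
  then have "psd (H x0 - K x0)" using x0(2) max by (intro hessian_psd_at_min) (auto simp: algebra_simps)
  then have "pucci c d (K x0) \<le> pucci c d (H x0)"
    using C2_hessian_sym[OF U x0(2)] cd by (intro pucci_mono)
  with ge[OF x0(1)] show "0 \<le> pucci c d (H x0) + \<mu> * f x0 * u x0" by linarith
qed

section \<open>Pucci operators on radial functions\<close>

text \<open>The contribution of one eigenvalue to \<open>pucci c d\<close>. Radial Hessians have at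
  most two distinct eigenvalues, so two such terms describe the operator on them.\<close>

definition pucci1 :: "real \<Rightarrow> real \<Rightarrow> real \<Rightarrow> real" where
  "pucci1 c d s = c * max s 0 - d * max (- s) 0"

lemma pucci1_nonneg: "0 \<le> s \<Longrightarrow> pucci1 c d s = c * s"
  and pucci1_nonpos: "s \<le> 0 \<Longrightarrow> pucci1 c d s = d * s"
  by (simp_all add: pucci1_def)

lemma pucci1_mult: "0 \<le> t \<Longrightarrow> pucci1 c d (t * s) = t * pucci1 c d s"
  by (cases "0 \<le> s") (simp_all add: pucci1_nonneg pucci1_nonpos mult_nonneg_nonpos)

text \<open>The symmetric matrix with eigenvalue \<open>b\<close> on the line through \<open>x\<close> and \<open>a\<close> on its complement.
  For \<open>x = 0\<close> it is \<open>a\<close> times the identity, whatever \<open>b\<close> is.\<close>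

definition radial_mat :: "real^'n \<Rightarrow> real \<Rightarrow> real \<Rightarrow> real^'n^'n" where
  "radial_mat x a b = a *\<^sub>R mat 1 + ((b - a) / (x \<bullet> x)) *\<^sub>R outer x"

lemma radial_mat_mult: "radial_mat x a b *v y = a *\<^sub>R y + ((b - a) / (x \<bullet> x) * (x \<bullet> y)) *\<^sub>R x"
  by (simp add: radial_mat_def matrix_vector_mult_add_rdistrib outer_mult flip: scaleR_matrix_vector_assoc)

lemma radial_mat_sym: "radial_mat x a b \<in> sym_mats"
  unfolding radial_mat_def by (intro sym_mats_add sym_mats_scale sym_mats_1 outer_sym)

lemma trace_scaleR: "trace (c *\<^sub>R A) = c * trace A" for A :: "real^'n^'n"
  by (simp add: trace_def sum_distrib_left)

lemma trace_radial_mat: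
  fixes x :: "real^'n"
  assumes "x = 0 \<Longrightarrow> a = b"
  shows "trace (radial_mat x a b) = (real CARD('n) - 1) * a + b"
proof -
  have "(b - a) / (x \<bullet> x) * (x \<bullet> x) = b - a" using assms by (cases "x = 0") simp_all
  then show ?thesis
    by (simp only: radial_mat_def trace_add trace_scaleR trace_outer trace_I) (simp add: algebra_simps)
qed

text \<open>The quadratic form is \<open>a\<close> times the squared component of \<open>y\<close>
  orthogonal to \<open>x\<close> plus \<open>b\<close> times the squared component along
  \<open>x\<close>; Cauchy-Schwarz makes the former nonnegative.\<close>

lemma psd_radial_mat:
  assumes "0 \<le> a" "0 \<le> b"
  shows "psd (radial_mat x a b)"
  unfolding psd_def
proof (intro conjI allI radial_mat_sym)
  fix y
  show "0 \<le> y \<bullet> (radial_mat x a b *v y)"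
  proof (cases "x = 0")
    case False
    have cs: "(x \<bullet> y)\<^sup>2 / (x \<bullet> x) \<le> y \<bullet> y"
      using Cauchy_Schwarz_ineq[of x y] False by (simp add: divide_le_eq mult.commute)
    have "y \<bullet> (radial_mat x a b *v y) = a * (y \<bullet> y - (x \<bullet> y)\<^sup>2 / (x \<bullet> x)) + b * ((x \<bullet> y)\<^sup>2 / (x \<bullet> x))"
      by (simp add: radial_mat_mult inner_add_right inner_commute[of y x] power2_eq_square
          diff_divide_distrib algebra_simps)
    also have "\<dots> \<ge> 0" using assms cs by simp
    finally show ?thesis .
  qed (use assms in \<open>simp add: radial_mat_mult\<close>)
qed

text \<open>Both matrices are diagonal in the same splitting, so their eigenvalues multiply. This
  makes the product of the two clipped matrices vanish below.\<close>

lemma radial_mat_mult_mult: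
  assumes "x \<noteq> 0"
  shows "radial_mat x a b *v (radial_mat x a' b' *v y) = radial_mat x (a * a') (b * b') *v y"
proof -
  define s k k' where "s = x \<bullet> y" and "k = (b - a) / (x \<bullet> x)" and "k' = (b' - a') / (x \<bullet> x)"
  have kq: "k * (x \<bullet> x) = b - a" "k' * (x \<bullet> x) = b' - a'" using assms by (simp_all add: k_def k'_def)
  have coeff: "(b * b' - a * a') / (x \<bullet> x) = a * k' + k * b'"
    using assms by (simp add: k_def k'_def field_simps)
  have "x \<bullet> (a' *\<^sub>R y + (k' * s) *\<^sub>R x) = a' * s + s * (k' * (x \<bullet> x))"
    by (simp add: inner_add_right s_def)
  also have "\<dots> = b' * s" by (simp add: kq algebra_simps)
  finally show ?thesis
    unfolding radial_mat_mult coeff s_def[symmetric] k_def[symmetric] k'_def[symmetric]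
    by (simp add: algebra_simps)
qed

text \<open>Clipping each eigenvalue yields radial matrices again, which are the positive and
  negative parts. The eigenvalue \<open>a\<close> has multiplicity \<open>N - 1\<close>.\<close>

lemma pucci_radial_mat:
  fixes x :: "real^'n"
  assumes "x = 0 \<Longrightarrow> a = b"
  shows "pucci c d (radial_mat x a b) = pucci1 c d b + (real CARD('n) - 1) * pucci1 c d a"
proof -
  let ?P = "radial_mat x (max a 0) (max b 0)" and ?Q = "radial_mat x (max (- a) 0) (max (- b) 0)"
  have "(?P ** ?Q) *v y = 0" for y
  proof (cases "x = 0")
    case True
    then show ?thesis by (simp add: radial_mat_mult max_def flip: matrix_vector_mul_assoc)
  next
    case False
    then show ?thesis
      by (simp add: radial_mat_mult_mult flip: matrix_vector_mul_assoc)
        (simp add: radial_mat_mult max_def)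
  qed
  then have "?P ** ?Q = 0" by (simp add: matrix_eq)
  moreover have "radial_mat x a b = ?P - ?Q"
    by (simp add: radial_mat_def max_def algebra_simps diff_divide_distrib)
  ultimately have "pos_neg_decomp (radial_mat x a b) ?P ?Q"
    unfolding pos_neg_decomp_def by (auto intro!: psd_radial_mat)
  then show ?thesis
    using assms by (simp add: pucci_decomp trace_radial_mat pucci1_def algebra_simps)
qed

text \<open>Profiles in \<open>x \<bullet> x\<close> rather than in the norm stay smooth at the
  origin, as the supersolution on the whole ball requires. The Hessian is
  \<open>2 w' I + 4 w'' x x^T\<close>.\<close>

lemma C2_radial:
  fixes U :: "(real^'n) set" and w w1 w2 :: "real \<Rightarrow> real"
  assumes U: "open U"
    and w: "\<And>x. x \<in> U \<Longrightarrow> (w has_real_derivative w1 (x \<bullet> x)) (at (x \<bullet> x))"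
    and w1: "\<And>x. x \<in> U \<Longrightarrow> (w1 has_real_derivative w2 (x \<bullet> x)) (at (x \<bullet> x))"
    and w2: "continuous_on U (\<lambda>x. w2 (x \<bullet> x))"
  shows "C2_with_hessian U (\<lambda>x. w (x \<bullet> x))
    (\<lambda>x. radial_mat x (2 * w1 (x \<bullet> x)) (2 * w1 (x \<bullet> x) + 4 * w2 (x \<bullet> x) * (x \<bullet> x)))"
proof -
  have H: "radial_mat x a (a + b * (x \<bullet> x)) = a *\<^sub>R mat 1 + b *\<^sub>R outer x" for x :: "real^'n" and a b
    by (cases "x = 0") (simp_all add: radial_mat_def outer_def vec_eq_iff)
  have q: "((\<lambda>x. x \<bullet> x) has_derivative (\<lambda>h. 2 * (x \<bullet> h))) (at x)" for x :: "real^'n"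
    by (auto intro!: derivative_eq_intros simp: inner_commute)
  have comp: "((\<lambda>x. f (x \<bullet> x)) has_derivative (\<lambda>h. 2 * f' * (x \<bullet> h))) (at x)"
    if "(f has_real_derivative f') (at (x \<bullet> x))" for f f' and x :: "real^'n"
    using has_derivative_compose[OF q, of f] that
    by (auto simp: has_field_derivative_def mult_ac)
  have "((\<lambda>x. (2 * w1 (x \<bullet> x)) *\<^sub>R x) has_derivative
      (\<lambda>h. (2 * w1 (x \<bullet> x)) *\<^sub>R h + (2 * (2 * w2 (x \<bullet> x) * (x \<bullet> h))) *\<^sub>R x)) (at x)" if "x \<in> U" for x
    by (intro has_derivative_scaleR has_derivative_mult_right comp w1 that has_derivative_ident)
  then have g: "((\<lambda>x. (2 * w1 (x \<bullet> x)) *\<^sub>R x) has_derivative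
      (\<lambda>h. ((2 * w1 (x \<bullet> x)) *\<^sub>R mat 1 + (4 * w2 (x \<bullet> x)) *\<^sub>R outer x) *v h)) (at x)" if "x \<in> U" for x
    using that by (simp add: matrix_vector_mult_add_rdistrib outer_mult mult.assoc flip: scaleR_matrix_vector_assoc)
  have cw1: "continuous_on U (\<lambda>x. w1 (x \<bullet> x))"
    using comp[OF w1] by (intro has_derivative_continuous_on) (blast intro: has_derivative_at_withinI)
  have "continuous_on U outer" unfolding outer_def by (intro continuous_intros)
  then have "continuous_on U (\<lambda>x. (2 * w1 (x \<bullet> x)) *\<^sub>R mat 1 + (4 * w2 (x \<bullet> x)) *\<^sub>R outer x)"
    using cw1 w2 by (intro continuous_intros)
  moreover have "((\<lambda>x. w (x \<bullet> x)) has_derivative (\<lambda>h. ((2 * w1 (x \<bullet> x)) *\<^sub>R x) \<bullet> h)) (at x)" if "x \<in> U" for x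
    using comp[OF w[OF that]] by simp
  ultimately show ?thesis
    unfolding C2_with_hessian_def H
    by (intro conjI exI[of _ "\<lambda>x. (2 * w1 (x \<bullet> x)) *\<^sub>R x"] ballI U g)
qed

lemma ln_norm_eq: "ln (norm x) = ln (x \<bullet> x) / 2" for x :: "'a::real_inner"
  by (cases "x = 0") (simp_all add: norm_eq_sqrt_inner ln_sqrt)

text \<open>In the variable \<open>s = ln r\<close> the Hessian eigenvalues are
  \<open>u' / r = K' / r^2\<close> and \<open>u'' = (K'' - K') / r^2\<close>, so the inverse-square
  potential leads to equations with constant coefficients.\<close>

lemma C2_radial_log:
  fixes U :: "(real^'n) set" and K K1 K2 :: "real \<Rightarrow> real"
  assumes U: "open U" "0 \<notin> U"
    and K: "\<And>x. x \<in> U \<Longrightarrow> (K has_real_derivative K1 (ln (norm x))) (at (ln (norm x)))"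
    and K1: "\<And>x. x \<in> U \<Longrightarrow> (K1 has_real_derivative K2 (ln (norm x))) (at (ln (norm x)))"
    and K2: "continuous_on U (\<lambda>x. K2 (ln (norm x)))"
  shows "C2_with_hessian U (\<lambda>x. K (ln (norm x)))
    (\<lambda>x. radial_mat x (K1 (ln (norm x)) / (norm x)\<^sup>2) ((K2 (ln (norm x)) - K1 (ln (norm x))) / (norm x)\<^sup>2))"
proof -
  have pos: "0 < x \<bullet> x" "0 < norm x" if "x \<in> U" for x using that U(2) by auto
  have L: "((\<lambda>q. f (ln q / 2)) has_real_derivative f' / (2 * (x \<bullet> x))) (at (x \<bullet> x))"
    if "x \<in> U" "(f has_real_derivative f') (at (ln (norm x)))" for x f f'
  proof -
    have "((\<lambda>q. ln q / 2) has_real_derivative 1 / (2 * (x \<bullet> x))) (at (x \<bullet> x))"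
      using pos[OF that(1)] by (auto intro!: derivative_eq_intros)
    from DERIV_chain2[OF that(2)[unfolded ln_norm_eq] this] show ?thesis by simp
  qed
  have c: "continuous_on U (\<lambda>x. K1 (ln (norm x)))"
  proof (rule continuous_at_imp_continuous_on, rule)
    fix x assume x: "x \<in> U"
    have "isCont (\<lambda>x. ln (norm x)) x" using pos[OF x] by (intro continuous_intros) auto
    then show "isCont (\<lambda>x. K1 (ln (norm x))) x"
      using DERIV_isCont[OF K1[OF x]] by (rule isCont_o2)
  qed
  \<comment> \<open>As \<open>ln r = ln q / 2\<close> for \<open>q = r^2\<close>, these are the
    first two derivatives of \<open>K (ln q / 2)\<close> in \<open>q\<close>.\<close>
  let ?w1 = "\<lambda>q. K1 (ln q / 2) / (2 * q)"
  let ?w2 = "\<lambda>q. (K2 (ln q / 2) - 2 * K1 (ln q / 2)) / (4 * q\<^sup>2)"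
  have "C2_with_hessian U (\<lambda>x. K (ln (x \<bullet> x) / 2))
    (\<lambda>x. radial_mat x (2 * ?w1 (x \<bullet> x)) (2 * ?w1 (x \<bullet> x) + 4 * ?w2 (x \<bullet> x) * (x \<bullet> x)))"
  proof (rule C2_radial[OF U(1)])
    fix x assume x: "x \<in> U"
    show "((\<lambda>q. K (ln q / 2)) has_real_derivative ?w1 (x \<bullet> x)) (at (x \<bullet> x))"
      using L[OF x K[OF x]] by (simp add: ln_norm_eq)
    show "(?w1 has_real_derivative ?w2 (x \<bullet> x)) (at (x \<bullet> x))"
    proof (rule DERIV_cong)
      have "((\<lambda>q. 2 * q) has_real_derivative 2) (at (x \<bullet> x))"
        by (auto intro!: derivative_eq_intros)
      from DERIV_divide[OF L[OF x K1[OF x]] this]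
      show "(?w1 has_real_derivative (K2 (ln (norm x)) / (2 * (x \<bullet> x)) * (2 * (x \<bullet> x)) - K1 (ln (x \<bullet> x) / 2) * 2)
          / (2 * (x \<bullet> x) * (2 * (x \<bullet> x)))) (at (x \<bullet> x))"
        using pos[OF x] by simp
    qed (use pos[OF x] in \<open>simp add: ln_norm_eq power2_eq_square\<close>)
  next
    show "continuous_on U (\<lambda>x. ?w2 (x \<bullet> x))"
      using c K2 pos unfolding ln_norm_eq by (intro continuous_intros) auto
  qed
  moreover have "radial_mat x (2 * ?w1 (x \<bullet> x)) (2 * ?w1 (x \<bullet> x) + 4 * ?w2 (x \<bullet> x) * (x \<bullet> x)) =
     radial_mat x (K1 (ln (norm x)) / (norm x)\<^sup>2) ((K2 (ln (norm x)) - K1 (ln (norm x))) / (norm x)\<^sup>2)"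
    for x :: "real^'n"
  proof (cases "x = 0")
    case False
    then have "2 * ?w1 (x \<bullet> x) + 4 * ?w2 (x \<bullet> x) * (x \<bullet> x) = (K2 (ln (norm x)) - K1 (ln (norm x))) / (x \<bullet> x)"
      by (simp add: ln_norm_eq power2_eq_square field_simps)
    then show ?thesis by (simp add: ln_norm_eq power2_norm_eq_inner)
  qed simp
  ultimately show ?thesis by (simp add: ln_norm_eq)
qed

lemma pucci_radial_log:
  fixes x :: "real^'n"
  assumes "x \<noteq> 0"
  shows "pucci c d (radial_mat x (k1 / (norm x)\<^sup>2) ((k2 - k1) / (norm x)\<^sup>2)) =
    (pucci1 c d (k2 - k1) + (real CARD('n) - 1) * pucci1 c d k1) / (norm x)\<^sup>2"
  using assms pucci1_mult[of "1 / (norm x)\<^sup>2" c d k1] pucci1_mult[of "1 / (norm x)\<^sup>2" c d "k2 - k1"]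
  by (simp add: pucci_radial_mat add_divide_distrib)

section \<open>Monotonicity of the principal eigenvalue\<close>

lemma princ_eig_ge:
  assumes "visc_supersol F \<mu> f \<Omega> u" "\<And>x. x \<in> \<Omega> \<Longrightarrow> 0 < u x"
  shows "ereal \<mu> \<le> princ_eig F f \<Omega>"
  unfolding princ_eig_def using assms
  by (intro Sup_upper imageI) (auto simp: visc_supersol_def)

lemma visc_supersolD:
  assumes "visc_supersol F \<mu> f \<Omega> u" "C2_with_hessian U \<phi> H" "U \<subseteq> \<Omega>" "x0 \<in> U"
    and "\<And>x. x \<in> U \<Longrightarrow> u x0 - \<phi> x0 \<le> u x - \<phi> x"
  shows "F (H x0) + \<mu> * f x0 * u x0 \<le> 0"
  using assms unfolding visc_supersol_def by blast

text \<open>This lets a single explicit solution bound several eigenvalues from below.\<close>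

lemma visc_supersol_mono:
  assumes "visc_supersol F \<mu> f \<Omega> u" "\<Omega>' \<subseteq> \<Omega>" "0 \<le> \<mu>"
    and "\<And>x. x \<in> \<Omega>' \<Longrightarrow> 0 \<le> u x" "\<And>x. x \<in> \<Omega>' \<Longrightarrow> f' x \<le> f x"
  shows "visc_supersol F \<mu> f' \<Omega>' u"
  unfolding visc_supersol_def
proof (intro conjI ballI allI impI)
  show "continuous_on \<Omega>' u"
    using assms(1,2) continuous_on_subset by (auto simp: visc_supersol_def)
  fix x0 U \<phi> H
  assume x0: "x0 \<in> \<Omega>'" and "x0 \<in> U" "U \<subseteq> \<Omega>'" "C2_with_hessian U \<phi> H"
    "\<forall>x\<in>U. u x0 - \<phi> x0 \<le> u x - \<phi> x"
  with assms(1,2) have "F (H x0) + \<mu> * f x0 * u x0 \<le> 0"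
    unfolding visc_supersol_def by (metis order_trans subsetD)
  moreover have "\<mu> * f' x0 * u x0 \<le> \<mu> * f x0 * u x0"
    using assms(3) assms(4,5)[OF x0] by (intro mult_right_mono mult_left_mono)
  ultimately show "F (H x0) + \<mu> * f' x0 * u x0 \<le> 0" by linarith
qed

text \<open>A supersolution for the larger operator is one for the smaller, so the order reverses.
  Hessians of test functions are symmetric, so comparison on \<open>sym_mats\<close>
  suffices.\<close>

lemma princ_eig_operator_mono:
  fixes F G :: "real^'n^'n \<Rightarrow> real"
  assumes "\<And>M. M \<in> sym_mats \<Longrightarrow> F M \<le> G M"
  shows "princ_eig G f \<Omega> \<le> princ_eig F f \<Omega>"
proof -
  have "visc_supersol F \<mu> f \<Omega> u" if "visc_supersol G \<mu> f \<Omega> u" for \<mu> u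
    using that assms C2_hessian_sym unfolding visc_supersol_def
    by (smt (verit, best))
  then show ?thesis
    unfolding princ_eig_def by (intro Sup_subset_mono image_mono) blast
qed

text \<open>Both \<open>M = P - Q\<close> and \<open>0\<close> are reached from \<open>- Q\<close>,
  by adding \<open>P\<close> and \<open>Q\<close>. Ellipticity bounds the two increments, and their
  difference is \<open>F M - F 0\<close>.\<close>

lemma elliptic_pucci_bounds:
  fixes F :: "real^'n^'n \<Rightarrow> real"
  assumes ell: "unif_elliptic lam Lam F" and hom: "pos_homogeneous F" and M: "M \<in> sym_mats"
  shows "pucci lam Lam M \<le> F M" "F M \<le> pucci Lam lam M"
proof -
  \<comment> \<open>Homogeneity with \<open>t = 2\<close> gives \<open>F 0 = 2 F 0\<close>.\<close>
  have F0: "F 0 = 0"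
    using hom[unfolded pos_homogeneous_def, rule_format, of 2 0] sym_mats_0 by simp
  define P Q where "P = mat_pos_part M" and "Q = mat_neg_part M"
  have d: "psd P" "psd Q" "M = P - Q"
    using pos_neg_decomp_parts[OF M] by (auto simp: pos_neg_decomp_def P_def Q_def)
  then have s: "P \<in> sym_mats" "Q \<in> sym_mats" by (auto simp: psd_def)
  have "lam * trace P \<le> F (- Q + P) - F (- Q)" "F (- Q + P) - F (- Q) \<le> Lam * trace P"
    "lam * trace Q \<le> F (- Q + Q) - F (- Q)" "F (- Q + Q) - F (- Q) \<le> Lam * trace Q"
    using ell d s sym_mats_uminus[OF s(2)] unfolding unif_elliptic_def by blast+
  then show "pucci lam Lam M \<le> F M" "F M \<le> pucci Lam lam M"
    unfolding pucci_def P_def[symmetric] Q_def[symmetric] using F0 d(3) by auto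
qed

section \<open>Explicit solutions\<close>

text \<open>For \<open>u\<close> decreasing and convex in \<open>r\<close>, the equation in
  \<open>s = ln r\<close> reads \<open>K'' + 2 \<tau> K' + \<tau>^2 K = 0\<close>. The root
  \<open>- \<tau>\<close> is double, and the solution with the factor \<open>- s\<close> is positive
  for \<open>s < 0\<close> and vanishes at \<open>s = 0\<close>.\<close>

lemma log_solution:
  assumes cd: "0 < c" "0 < d" and \<tau>: "0 < \<tau>" "d * (real CARD('n) - 1) = c * (2 * \<tau> + 1)"
  shows "solves_punctured_dirichlet (pucci c d :: real^'n^'n \<Rightarrow> real) (c * \<tau>\<^sup>2)
    (\<lambda>x. norm x powr (- \<tau>) * (- ln (norm x)))"
proof -
  let ?\<Omega> = "ball 0 1 - {0} :: (real^'n) set"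
  define K where "K = (\<lambda>s. exp (- \<tau> * s) * (- s))"
  define K1 where "K1 = (\<lambda>s. exp (- \<tau> * s) * (\<tau> * s - 1))"
  define K2 where "K2 = (\<lambda>s. exp (- \<tau> * s) * (2 * \<tau> - \<tau>\<^sup>2 * s))"
  let ?H = "\<lambda>x::real^'n. radial_mat x (K1 (ln (norm x)) / (norm x)\<^sup>2) ((K2 (ln (norm x)) - K1 (ln (norm x))) / (norm x)\<^sup>2)"
  have u: "(\<lambda>x. norm x powr (- \<tau>) * (- ln (norm x))) = (\<lambda>x::real^'n. K (ln (norm x)))"
    by (auto simp: fun_eq_iff K_def powr_def)
  have cont: "continuous_on (- {0}) (\<lambda>x::real^'n. K (ln (norm x)))"
    unfolding K_def by (auto intro!: continuous_intros)
  have C2: "C2_with_hessian ?\<Omega> (\<lambda>x. K (ln (norm x))) ?H"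
  proof (rule C2_radial_log)
    show "(K has_real_derivative K1 (ln (norm x))) (at (ln (norm x)))" for x :: "real^'n"
      unfolding K_def K1_def by (auto intro!: derivative_eq_intros simp: algebra_simps)
    show "(K1 has_real_derivative K2 (ln (norm x))) (at (ln (norm x)))" for x :: "real^'n"
      unfolding K1_def K2_def by (auto intro!: derivative_eq_intros simp: algebra_simps power2_eq_square)
    show "continuous_on ?\<Omega> (\<lambda>x. K2 (ln (norm x)))"
      unfolding K2_def by (auto intro!: continuous_intros)
  qed (auto intro: open_delete)
  have eq: "pucci c d (?H x) + c * \<tau>\<^sup>2 * (1 / (norm x)\<^sup>2) * K (ln (norm x)) = 0" if "x \<in> ?\<Omega>" for x
  proof -
    define s where "s = ln (norm x)"
    have s: "s < 0" using that by (auto simp: s_def)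
    have "\<tau> * s < 0" using s \<tau> by (simp add: mult_pos_neg)
    \<comment> \<open>Facts \<open>1\<close> and \<open>2\<close> fix the signs of the Hessian
      eigenvalues, so the operator acts linearly.\<close>
    then have 1: "K1 s \<le> 0" unfolding K1_def by (intro mult_nonneg_nonpos) auto
    have "K2 s - K1 s = exp (- \<tau> * s) * (2 * \<tau> + 1 - \<tau> * (\<tau> * s) - \<tau> * s)"
      by (simp add: K2_def K1_def algebra_simps power2_eq_square)
    moreover have "\<tau> * (\<tau> * s) < 0" using \<open>\<tau> * s < 0\<close> \<tau> by (simp add: mult_pos_neg)
    ultimately have 2: "0 \<le> K2 s - K1 s" using \<tau> \<open>\<tau> * s < 0\<close> by simp
    have "pucci1 c d (K2 s - K1 s) + (real CARD('n) - 1) * pucci1 c d (K1 s)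
      = c * (K2 s - K1 s) + (d * (real CARD('n) - 1)) * K1 s"
      using 1 2 by (simp add: pucci1_nonneg pucci1_nonpos)
    also have "\<dots> = - (c * \<tau>\<^sup>2 * K s)"
      unfolding \<tau>(2) by (simp add: K_def K1_def K2_def algebra_simps power2_eq_square)
    finally have "pucci c d (?H x) = - (c * \<tau>\<^sup>2 * K s) / (norm x)\<^sup>2"
      using that pucci_radial_log[of x c d "K1 s" "K2 s"] by (simp add: s_def)
    then show ?thesis by (simp add: s_def)
  qed
  have "visc_sol (pucci c d) (c * \<tau>\<^sup>2) (\<lambda>x. 1 / (norm x)\<^sup>2) ?\<Omega> (\<lambda>x. K (ln (norm x)))"
    unfolding visc_sol_def using cd eq cont
    by (intro conjI visc_supersol_classical[OF C2] visc_subsol_classical[OF C2])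
      (auto elim: continuous_on_subset)
  then show ?thesis
    unfolding solves_punctured_dirichlet_def u
    using continuous_on_subset[OF cont, of "cball 0 1 - {0}"] by (auto simp: K_def)
qed

text \<open>The logarithmic solution is singular at the origin; on the whole ball it is replaced by
  the power \<open>r powr (- \<tau>)\<close> with \<open>r^2\<close> shifted by \<open>e\<close>.
  The inequality rests on \<open>q \<le> q + e\<close> for \<open>q = r^2\<close>.\<close>

lemma regularized_supersolution:
  assumes cd: "0 < c" "0 < d" and \<tau>: "0 < \<tau>" "d * (real CARD('n) - 1) = c * (2 * \<tau> + 1)"
    and e: "0 < e"
  shows "visc_supersol (pucci c d :: real^'n^'n \<Rightarrow> real) (c * \<tau>\<^sup>2)
    (\<lambda>x. 1 / ((norm x)\<^sup>2 + e)) (ball 0 1) (\<lambda>x. exp (- (\<tau> / 2) * ln (x \<bullet> x + e)))"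
proof -
  define w where "w = (\<lambda>q. exp (- (\<tau> / 2) * ln (q + e)))"
  define w1 where "w1 = (\<lambda>q. - (\<tau> / 2) * w q / (q + e))"
  define w2 where "w2 = (\<lambda>q. (\<tau> / 2) * (\<tau> / 2 + 1) * w q / (q + e)\<^sup>2)"
  let ?H = "\<lambda>x::real^'n. radial_mat x (2 * w1 (x \<bullet> x)) (2 * w1 (x \<bullet> x) + 4 * w2 (x \<bullet> x) * (x \<bullet> x))"
  have pos: "0 < x \<bullet> x + e" for x :: "real^'n" using e by (simp add: add_nonneg_pos)
  have Dw: "(w has_real_derivative w1 q) (at q)" if "0 < q + e" for q
    unfolding w1_def using that unfolding w_def
    by (auto intro!: derivative_eq_intros simp: field_simps)
  have Dw1: "(w1 has_real_derivative w2 q) (at q)" if "0 < q + e" for q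
  proof -
    have "((\<lambda>q. - (\<tau> / 2) * w q / (q + e)) has_real_derivative
        ((- (\<tau> / 2) * w1 q) * (q + e) - (- (\<tau> / 2) * w q) * 1) / ((q + e) * (q + e))) (at q)"
      using that by (intro DERIV_divide DERIV_cmult Dw) (auto intro!: derivative_eq_intros)
    moreover have "((- (\<tau> / 2) * w1 q) * (q + e) - (- (\<tau> / 2) * w q) * 1) / ((q + e) * (q + e)) = w2 q"
    proof -
      have 1: "w1 q * (q + e) = - (\<tau> / 2) * w q"
        by (subst nonzero_eq_divide_eq[symmetric]) (use that in \<open>simp_all add: w1_def\<close>)
      have "(- (\<tau> / 2) * w1 q) * (q + e) - (- (\<tau> / 2) * w q) * 1 = (\<tau> / 2) * (\<tau> / 2 + 1) * w q"
        unfolding mult.assoc 1 by (simp add: algebra_simps)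
      then show ?thesis by (simp only: w2_def power2_eq_square)
    qed
    ultimately show ?thesis by (simp add: w1_def)
  qed
  have cont: "continuous_on (ball 0 1) (\<lambda>x::real^'n. w (x \<bullet> x))"
    unfolding w_def using pos by (auto intro!: continuous_intros simp: less_imp_neq[symmetric])
  have C2: "C2_with_hessian (ball 0 1) (\<lambda>x. w (x \<bullet> x)) ?H"
  proof (rule C2_radial)
    show "continuous_on (ball 0 1) (\<lambda>x::real^'n. w2 (x \<bullet> x))"
      unfolding w2_def using cont pos by (auto intro!: continuous_intros simp: less_imp_neq[symmetric])
  qed (auto intro: Dw Dw1 pos)
  have le: "pucci c d (?H x) + c * \<tau>\<^sup>2 * (1 / ((norm x)\<^sup>2 + e)) * w (x \<bullet> x) \<le> 0" for x
  proof -
    define q where "q = x \<bullet> x"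
    have qe: "0 < q + e" "0 \<le> q" using pos by (auto simp: q_def)
    define r where "r = q + e"
    have r: "0 < r" "q \<le> r" using qe e by (simp_all add: r_def)
    define k where "k = w q / r"
    have k: "0 < k" using r by (simp add: k_def w_def)
    have w1r: "w1 q = - (\<tau> / 2) * w q / r" and w2r: "w2 q = (\<tau> / 2) * (\<tau> / 2 + 1) * w q / r\<^sup>2"
      by (simp_all only: w1_def w2_def r_def)
    \<comment> \<open>After extracting \<open>k\<close>, the Hessian eigenvalues are
      \<open>- \<tau>\<close> and \<open>X\<close>. For \<open>e = 0\<close> and
      \<open>q > 0\<close>, \<open>X\<close> would be \<open>\<tau> (\<tau> + 1)\<close>, the value
      for the pure power.\<close>
    define X where "X = \<tau> * ((\<tau> + 2) * (q / r) - 1)"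
    have a: "2 * w1 q = k * (- \<tau>)" by (simp add: w1r k_def)
    have b: "2 * w1 q + 4 * w2 q * q = k * X"
      using r(1) by (simp add: w1r w2r k_def X_def power2_eq_square field_simps)
    have "(\<tau> + 2) * (q / r) \<le> (\<tau> + 2) * 1"
      using \<tau> r by (intro mult_left_mono) auto
    then have X: "X \<le> \<tau> * (\<tau> + 1)" unfolding X_def using \<tau> by (intro mult_left_mono) auto
    \<comment> \<open>Near the origin \<open>X\<close> is negative, and then the left side is
      nonpositive.\<close>
    have X': "pucci1 c d X \<le> c * (\<tau> * (\<tau> + 1))"
    proof (cases "0 \<le> X")
      case True
      then show ?thesis using X cd by (simp add: pucci1_nonneg)
    next
      case False
      then have "d * X \<le> 0" "0 \<le> c * (\<tau> * (\<tau> + 1))" using cd \<tau> by (auto simp: mult_nonneg_nonpos)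
      with False show ?thesis by (simp add: pucci1_nonpos)
    qed
    have "pucci c d (?H x) = pucci1 c d (k * X) + (real CARD('n) - 1) * pucci1 c d (k * (- \<tau>))"
      unfolding q_def[symmetric] a b[unfolded a]
      by (rule pucci_radial_mat) (use b[unfolded a] in \<open>simp add: q_def\<close>)
    also have "\<dots> = k * (pucci1 c d X - (d * (real CARD('n) - 1)) * \<tau>)"
      using k \<tau>(1) pucci1_mult[of k c d X] pucci1_mult[of k c d "- \<tau>"]
      by (simp add: pucci1_nonpos algebra_simps)
    also have "\<dots> \<le> k * (c * (\<tau> * (\<tau> + 1)) - c * (2 * \<tau> + 1) * \<tau>)"
      unfolding \<tau>(2) using X' k by (intro mult_left_mono) auto
    also have "\<dots> = - (c * \<tau>\<^sup>2 * k)" by (simp add: algebra_simps power2_eq_square)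
    finally show ?thesis by (simp add: k_def r_def q_def power2_norm_eq_inner)
  qed
  have "visc_supersol (pucci c d) (c * \<tau>\<^sup>2) (\<lambda>x. 1 / ((norm x)\<^sup>2 + e)) (ball 0 1) (\<lambda>x::real^'n. w (x \<bullet> x))"
    using cd le cont by (intro visc_supersol_classical[OF C2]) auto
  then show ?thesis by (simp add: w_def)
qed

section \<open>Upper bound\<close>

text \<open>Here \<open>T = - r v' / v = tan (\<kappa> (ln r - s))\<close> for the function \<open>v\<close> of the introduction, so that
  \<open>r\<^sup>2 v'' / v = (1 - \<kappa>) T\<^sup>2 + T - \<kappa>\<close>, and \<open>m = N - 1\<close>.\<close>

lemma riccati_inequality:
  assumes cd: "0 < c" "0 < d" and \<tau>: "d * m = c * (2 * \<tau> + 1)" "d \<le> c * m"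
    and \<kappa>: "0 < \<kappa>" "\<kappa> < 1" and \<mu>: "c * \<tau>\<^sup>2 \<le> (1 - \<kappa>) * (\<mu> - c * \<kappa>)" "d * \<kappa> * (1 + m) \<le> \<mu>"
  shows "0 \<le> pucci1 c d ((1 - \<kappa>) * T\<^sup>2 + T - \<kappa>) + m * pucci1 c d (- T) + \<mu>"
proof -
  define X where "X = (1 - \<kappa>) * T\<^sup>2 + T - \<kappa>"
  have m: "0 < m" using \<tau>(2) cd by (metis less_le_trans zero_less_mult_pos)
  have sq: "0 \<le> (1 - \<kappa>) * T\<^sup>2" using \<kappa> by simp
  have d\<kappa>: "0 < d * \<kappa>" "0 < d * \<kappa> * m" using cd \<kappa> m by auto
  then have d\<mu>: "d * \<kappa> \<le> \<mu>" using \<mu>(2) by (simp add: algebra_simps)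
  have "0 \<le> pucci1 c d X + m * pucci1 c d (- T) + \<mu>"
  proof (cases "0 \<le> T")
    case T: True
    then have mT: "m * pucci1 c d (- T) = - (c * (2 * \<tau> + 1) * T)"
      by (simp add: pucci1_nonpos flip: \<tau>(1))
    show ?thesis
    proof (cases "0 \<le> X")
      case True
      \<comment> \<open>Multiplied by \<open>1 - \<kappa>\<close>, the quadratic in \<open>T\<close>
        completes to this square; the first condition on \<open>\<mu>\<close> covers the remaining
        constant.\<close>
      have "0 \<le> c * ((1 - \<kappa>) * T - \<tau>)\<^sup>2 + ((1 - \<kappa>) * (\<mu> - c * \<kappa>) - c * \<tau>\<^sup>2)"
        using cd \<mu>(1) by simp
      also have "\<dots> = (1 - \<kappa>) * (c * X - c * (2 * \<tau> + 1) * T + \<mu>)"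
        by (simp add: X_def power2_eq_square algebra_simps)
      finally show ?thesis using True \<kappa> mT by (simp add: pucci1_nonneg zero_le_mult_iff)
    next
      case False
      \<comment> \<open>With \<open>T\<close> this small, both negative terms are of order
        \<open>\<kappa>\<close> and are absorbed by the second condition on
        \<open>\<mu>\<close>.\<close>
      then have "T < \<kappa>" using sq by (simp add: X_def)
      then have "c * (2 * \<tau> + 1) * T \<le> d * m * \<kappa>"
        unfolding \<tau>(1)[symmetric] using cd m by (intro mult_left_mono) auto
      moreover have "d * (- \<kappa>) \<le> d * X" unfolding X_def using cd sq T by (intro mult_left_mono) auto
      ultimately show ?thesis using False mT \<mu>(2) by (simp add: pucci1_nonpos algebra_simps)
    qed
  next
    case T: False
    then have mT: "m * pucci1 c d (- T) = c * m * (- T)" by (simp add: pucci1_nonneg)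
    show ?thesis
    proof (cases "0 \<le> X")
      case True
      moreover have "0 \<le> c * m * (- T)" using T cd m by (intro mult_nonneg_nonneg) auto
      moreover have "0 \<le> c * X" using True cd by simp
      ultimately show ?thesis using mT d\<mu> d\<kappa> by (simp add: pucci1_nonneg)
    next
      case False
      have "d * (T - \<kappa>) \<le> d * X" unfolding X_def using cd sq by (intro mult_left_mono) auto
      \<comment> \<open>Here \<open>v\<close> is increasing: the positive tangential term outweighs
        the negative part \<open>d T\<close> of the radial one.\<close>
      moreover have "d * (- T) \<le> c * m * (- T)" using \<tau>(2) T by (intro mult_right_mono) auto
      ultimately show ?thesis using False mT d\<mu> by (simp add: pucci1_nonpos algebra_simps)
    qed
  qed
  then show ?thesis by (simp add: X_def)
qed

text \<open>The width of the annulus depends only on \<open>\<mu>'\<close>. The proof takes \<open>\<kappa> = 1 / n\<close>, so that the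
  function \<open>v\<close> is a natural power of a cosine.\<close>

lemma princ_eig_upper:
  assumes cd: "0 < c" "0 < d" and \<tau>: "0 < \<tau>" "d * (real CARD('n) - 1) = c * (2 * \<tau> + 1)"
    and m: "d \<le> c * (real CARD('n) - 1)" and \<mu>': "c * \<tau>\<^sup>2 < \<mu>'"
  obtains a b :: real where "0 < a" "a < b" "b < 1"
    "\<And>\<Omega> f \<theta>. (\<And>x. a \<le> norm x \<Longrightarrow> norm x \<le> b \<Longrightarrow> x \<in> \<Omega>) \<Longrightarrow> 0 < \<theta> \<Longrightarrow>
      (\<And>x. a \<le> norm x \<Longrightarrow> norm x \<le> b \<Longrightarrow> \<theta> / (norm x)\<^sup>2 \<le> f x) \<Longrightarrow>
      princ_eig (pucci c d :: real^'n^'n \<Rightarrow> real) f \<Omega> \<le> ereal (\<mu>' / \<theta>)"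
proof -
  let ?m = "real CARD('n) - 1"
  \<comment> \<open>As \<open>\<kappa> = 1 / n\<close> tends to \<open>0\<close>, the two conditions
    of \<open>riccati_inequality\<close> tend to \<open>c \<tau>^2 \<le> \<mu>'\<close> and
    \<open>0 \<le> \<mu>'\<close>, both strict here, so a large \<open>n\<close> satisfies
    them.\<close>
  have "(\<lambda>n. (1 - 1 / real n) * (\<mu>' - c * (1 / real n))) \<longlonglongrightarrow> (1 - 0) * (\<mu>' - c * 0)"
    by (intro tendsto_intros lim_1_over_n)
  then have ev1: "\<forall>\<^sub>F n in sequentially. c * \<tau>\<^sup>2 < (1 - 1 / real n) * (\<mu>' - c * (1 / real n))"
    using \<mu>' by (intro order_tendstoD(1)) auto
  have "(\<lambda>n. d * (1 / real n) * (1 + ?m)) \<longlonglongrightarrow> d * 0 * (1 + ?m)"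
    by (intro tendsto_intros lim_1_over_n)
  moreover have "0 \<le> c * \<tau>\<^sup>2" using cd by simp
  then have "0 < \<mu>'" using \<mu>' by linarith
  ultimately have ev2: "\<forall>\<^sub>F n in sequentially. d * (1 / real n) * (1 + ?m) < \<mu>'"
    by (intro order_tendstoD(2)) auto
  obtain n :: nat where n: "2 \<le> n" "c * \<tau>\<^sup>2 < (1 - 1 / real n) * (\<mu>' - c * (1 / real n))"
    "d * (1 / real n) * (1 + ?m) < \<mu>'"
    using eventually_conj[OF eventually_ge_at_top[of 2] eventually_conj[OF ev1 ev2]]
    by (auto simp: eventually_sequentially)
  define \<kappa> where "\<kappa> = 1 / real n"
  have \<kappa>: "0 < \<kappa>" "\<kappa> < 1" "real n * \<kappa> = 1" using n(1) by (auto simp: \<kappa>_def)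
  have ric: "0 \<le> pucci1 c d ((1 - \<kappa>) * T\<^sup>2 + T - \<kappa>) + ?m * pucci1 c d (- T) + \<mu>'" for T
    using cd \<tau> m \<kappa> n by (intro riccati_inequality) (auto simp: \<kappa>_def)
  \<comment> \<open>The outer radius is an arbitrary number in \<open>(0, 1)\<close>;
    \<open>s1\<close> and \<open>a\<close> are then such that the angle
    \<open>\<kappa> (ln r - s1)\<close> runs from \<open>- pi / 2\<close> to \<open>pi / 2\<close>
    across the annulus.\<close>
  define b :: real where "b = 1 / 2"
  define s1 where "s1 = ln b - pi * n / 2"
  define a where "a = exp (s1 - pi * n / 2)"
  have lna: "ln a = s1 - pi * n / 2" and lnb: "ln b = s1 + pi * n / 2" by (simp_all add: a_def s1_def)
  have ab: "0 < a" "a < b" "b < 1"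
  proof -
    show "0 < a" "b < 1" by (auto simp: a_def b_def)
    moreover have "ln a < ln b" unfolding lna lnb using n(1) by simp
    ultimately show "a < b" by (simp add: b_def)
  qed
  define ang where "ang = (\<lambda>s. \<kappa> * (s - s1))"
  define K where "K = (\<lambda>s. cos (ang s) ^ n)"
  define T where "T = (\<lambda>s. tan (ang s))"
  have ang_le: "\<bar>ang (ln (norm x))\<bar> \<le> pi / 2" if "a \<le> norm x" "norm x \<le> b" for x :: "real^'n"
  proof -
    have "0 < norm x" "0 < b" using that ab by linarith+
    then have "ln a \<le> ln (norm x)" "ln (norm x) \<le> ln b" using that ab by simp_all
    then have "\<kappa> * (- (pi * n / 2)) \<le> ang (ln (norm x))" "ang (ln (norm x)) \<le> \<kappa> * (pi * n / 2)"
      unfolding ang_def lna lnb using \<kappa> by (intro mult_left_mono; simp)+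
    moreover have "\<kappa> * (pi * n / 2) = pi / 2" "\<kappa> * (- (pi * n / 2)) = - (pi / 2)"
      using n by (simp_all add: \<kappa>_def)
    ultimately show ?thesis by linarith
  qed
  have ang_less: "\<bar>ang (ln (norm x))\<bar> < pi / 2" if "a < norm x" "norm x < b" for x :: "real^'n"
  proof -
    have "0 < norm x" "0 < b" using that ab by linarith+
    then have "ln a < ln (norm x)" "ln (norm x) < ln b" using that ab by simp_all
    then have "\<kappa> * (- (pi * n / 2)) < ang (ln (norm x))" "ang (ln (norm x)) < \<kappa> * (pi * n / 2)"
      unfolding ang_def lna lnb using \<kappa> by (intro mult_strict_left_mono; simp)+
    moreover have "\<kappa> * (pi * n / 2) = pi / 2" "\<kappa> * (- (pi * n / 2)) = - (pi / 2)"
      using n by (simp_all add: \<kappa>_def)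
    ultimately show ?thesis by linarith
  qed
  have K_nonneg: "0 \<le> K (ln (norm x))" if "a \<le> norm x" "norm x \<le> b" for x :: "real^'n"
    unfolding K_def using ang_le[OF that] by (intro zero_le_power cos_ge_zero) auto
  have K_bdry: "K (ln (norm x)) = 0" if "norm x = a \<or> norm x = b" for x :: "real^'n"
  proof -
    have "ang (ln a) = - (pi / 2)" "ang (ln b) = pi / 2"
      using n unfolding ang_def lna lnb by (simp_all add: \<kappa>_def)
    then have "ang (ln (norm x)) = - (pi / 2) \<or> ang (ln (norm x)) = pi / 2" using that by metis
    then have "cos (ang (ln (norm x))) = 0" by (elim disjE) (simp_all only: cos_minus cos_pi_half)
    then show ?thesis using n by (simp add: K_def)
  qed
  show thesis
  proof (rule that[OF ab])
    fix \<Omega> :: "(real^'n) set" and f :: "real^'n \<Rightarrow> real" and \<theta> :: real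
    assume \<Omega>: "\<And>x. a \<le> norm x \<Longrightarrow> norm x \<le> b \<Longrightarrow> x \<in> \<Omega>" and \<theta>: "0 < \<theta>"
      and f: "\<And>x. a \<le> norm x \<Longrightarrow> norm x \<le> b \<Longrightarrow> \<theta> / (norm x)\<^sup>2 \<le> f x"
    have "\<mu> \<le> \<mu>' / \<theta>" if u: "continuous_on \<Omega> u" "\<forall>x\<in>\<Omega>. 0 < u x" "visc_supersol (pucci c d) \<mu> f \<Omega> u"
      for \<mu> and u :: "real^'n \<Rightarrow> real"
    proof (rule ccontr)
      assume "\<not> \<mu> \<le> \<mu>' / \<theta>"
      then have \<mu>: "\<mu>' < \<mu> * \<theta>" using \<theta> by (simp add: field_simps)
      then have "0 < \<mu>" using \<open>0 < \<mu>'\<close> \<theta> by (metis less_trans zero_less_mult_pos2)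
      let ?A = "cball 0 b - ball 0 a :: (real^'n) set"
      have A: "x \<in> ?A \<longleftrightarrow> a \<le> norm x \<and> norm x \<le> b" for x by auto
      have A\<Omega>: "?A \<subseteq> \<Omega>" using \<Omega> A by blast
      \<comment> \<open>On this sphere the cosine is \<open>1\<close>, which makes the maximum of
        \<open>v / u\<close> positive.\<close>
      obtain e :: "real^'n" where e: "norm e = exp s1" using vector_choose_size[of "exp s1"] by auto
      have "exp s1 \<le> exp (ln b)" unfolding lnb by simp
      then have "a \<le> exp s1" "exp s1 \<le> b" using ab by (simp_all add: a_def)
      then have eA: "e \<in> ?A" using A e by simp
      have Ke: "K (ln (norm e)) = 1" by (simp add: e K_def ang_def)
      have "x \<noteq> 0" "u x \<noteq> 0" if "x \<in> ?A" for x
        using that u(2) A\<Omega> ab by fastforce+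
      then have "continuous_on ?A (\<lambda>x. K (ln (norm x)) / u x)"
        unfolding K_def ang_def using continuous_on_subset[OF u(1) A\<Omega>]
        by (intro continuous_intros) auto
      moreover have "compact ?A" by (intro compact_diff) auto
      ultimately obtain x0 where x0: "x0 \<in> ?A" and max: "\<And>x. x \<in> ?A \<Longrightarrow> K (ln (norm x)) / u x \<le> K (ln (norm x0)) / u x0"
        using continuous_attains_sup[of ?A] eA by blast
      have u0: "0 < u x0" using u(2) x0 A\<Omega> by blast
      have "0 < K (ln (norm e)) / u e" using u(2) eA A\<Omega> Ke by auto
      also note max[OF eA]
      finally have K0: "0 < K (ln (norm x0))" using u0 by (simp add: zero_less_divide_iff)
      \<comment> \<open>Now \<open>t v\<close> equals \<open>u\<close> at \<open>x0\<close>, and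
        maximality of \<open>v / u\<close> gives \<open>t v \<le> u\<close> on the annulus.\<close>
      define t where "t = u x0 / K (ln (norm x0))"
      have t: "0 < t" using u0 K0 by (simp add: t_def)
      let ?U = "ball 0 b - cball 0 a :: (real^'n) set"
      \<comment> \<open>\<open>v\<close> vanishes on the boundary spheres but not at
        \<open>x0\<close>, so \<open>x0\<close> is interior.\<close>
      have x0U: "x0 \<in> ?U" using x0 K0 K_bdry[of x0] A[of x0] by (auto simp: less_le)
      have cosU: "0 < cos (ang (ln (norm x)))" if "x \<in> ?U" for x
        using ang_less[of x] that by (intro cos_gt_zero_pi) auto
      \<comment> \<open>Derivatives of \<open>K\<close> written with the tangent:
        \<open>K' = - T K\<close> because \<open>n \<kappa> = 1\<close>, and
        \<open>T' = \<kappa> (1 + T^2)\<close>.\<close>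
      define K1 where "K1 = (\<lambda>s. - T s * K s)"
      define K2 where "K2 = (\<lambda>s. ((T s)\<^sup>2 - \<kappa> * (1 + (T s)\<^sup>2)) * K s)"
      have DK: "((\<lambda>s. t * K s) has_real_derivative t * K1 s) (at s)" if "0 < cos (ang s)" for s
      proof -
        have "(K has_real_derivative (real n * cos (ang s) ^ (n - 1) * (- sin (ang s) * \<kappa>))) (at s)"
          unfolding K_def ang_def by (auto intro!: derivative_eq_intros)
        moreover have "real n * cos (ang s) ^ (n - 1) * (- sin (ang s) * \<kappa>) = K1 s"
        proof -
          have "cos (ang s) ^ n = cos (ang s) * cos (ang s) ^ (n - 1)"
            using n(1) by (metis Suc_diff_1 less_le_trans pos2 power_Suc)
          then have "K1 s = - sin (ang s) * cos (ang s) ^ (n - 1) * (real n * \<kappa>)"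
            using that \<kappa>(3) by (simp add: K1_def T_def K_def tan_def)
          then show ?thesis by (simp add: mult_ac)
        qed
        ultimately show ?thesis by (auto intro: DERIV_cmult)
      qed
      have DK1: "((\<lambda>s. t * K1 s) has_real_derivative t * K2 s) (at s)" if "0 < cos (ang s)" for s
      proof -
        have "(K has_real_derivative K1 s) (at s)"
          using DERIV_cmult[OF DK[OF that], of "1 / t"] t by simp
        moreover have "(T has_real_derivative \<kappa> * (1 + (T s)\<^sup>2)) (at s)"
          unfolding T_def ang_def using that
          by (auto intro!: derivative_eq_intros simp: ang_def tan_sec power_inverse)
        ultimately have "(K1 has_real_derivative - (\<kappa> * (1 + (T s)\<^sup>2)) * K s + K1 s * (- T s)) (at s)"
          unfolding K1_def by (intro DERIV_mult DERIV_minus)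
        then show ?thesis
          by (intro DERIV_cmult) (simp add: K1_def K2_def algebra_simps power2_eq_square)
      qed
      have "x \<noteq> 0" "cos (\<kappa> * (ln (norm x) - s1)) \<noteq> 0" if "x \<in> ?U" for x
        using cosU[OF that] that ab by (auto simp: ang_def)
      then have "continuous_on ?U (\<lambda>x. K2 (ln (norm x)))"
        unfolding K2_def T_def K_def ang_def tan_def by (intro continuous_intros) auto
      then have C2: "C2_with_hessian ?U (\<lambda>x. t * K (ln (norm x)))
        (\<lambda>x. radial_mat x (t * K1 (ln (norm x)) / (norm x)\<^sup>2) ((t * K2 (ln (norm x)) - t * K1 (ln (norm x))) / (norm x)\<^sup>2))"
        using ab cosU DK DK1 by (intro C2_radial_log continuous_intros) auto
      define s where "s = ln (norm x0)"
      have nx0: "0 < norm x0" using x0 A ab by (metis less_le_trans)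
      have touch: "u x0 - t * K (ln (norm x0)) \<le> u x - t * K (ln (norm x))" if "x \<in> ?U" for x
      proof -
        have "x \<in> ?A" using that by auto
        then have ux: "0 < u x" using u(2) A\<Omega> by blast
        have "K (ln (norm x)) / u x \<le> 1 / t" using max[OF \<open>x \<in> ?A\<close>] by (simp add: t_def)
        then have "t * K (ln (norm x)) \<le> u x" using ux t by (simp add: field_simps)
        then show ?thesis using K0 by (simp add: t_def)
      qed
      have "pucci c d (radial_mat x0 (t * K1 s / (norm x0)\<^sup>2) ((t * K2 s - t * K1 s) / (norm x0)\<^sup>2)) + \<mu> * f x0 * u x0 \<le> 0"
        unfolding s_def
      proof (rule visc_supersolD[OF u(3) C2 _ x0U touch])
        show "?U \<subseteq> \<Omega>" using A\<Omega> by auto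
      qed
      moreover have "pucci c d (radial_mat x0 (t * K1 s / (norm x0)\<^sup>2) ((t * K2 s - t * K1 s) / (norm x0)\<^sup>2))
         \<ge> - \<mu>' * u x0 / (norm x0)\<^sup>2"
      proof -
        have tK: "u x0 = t * K s" using K0 by (simp add: t_def s_def)
        have eqs: "t * K2 s - t * K1 s = u x0 * ((1 - \<kappa>) * (T s)\<^sup>2 + T s - \<kappa>)" "t * K1 s = u x0 * (- T s)"
          by (simp_all add: tK K1_def K2_def algebra_simps)
        have "pucci1 c d (t * K2 s - t * K1 s) + ?m * pucci1 c d (t * K1 s) =
            u x0 * pucci1 c d ((1 - \<kappa>) * (T s)\<^sup>2 + T s - \<kappa>) + ?m * (u x0 * pucci1 c d (- T s))"
          unfolding eqs(1) unfolding eqs(2) using u0 by (simp only: pucci1_mult less_imp_le)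
        also have "\<dots> = u x0 * (pucci1 c d ((1 - \<kappa>) * (T s)\<^sup>2 + T s - \<kappa>) + ?m * pucci1 c d (- T s))"
          by (simp only: distrib_left mult.left_commute)
        also have "\<dots> \<ge> u x0 * (- \<mu>')" using ric[of "T s"] u0 by (intro mult_left_mono) auto
        finally have "u x0 * (- \<mu>') / (norm x0)\<^sup>2 \<le>
            (pucci1 c d (t * K2 s - t * K1 s) + ?m * pucci1 c d (t * K1 s)) / (norm x0)\<^sup>2"
          by (rule divide_right_mono) simp
        moreover have "u x0 * (- \<mu>') = - \<mu>' * u x0" by simp
        ultimately show ?thesis
          using pucci_radial_log[of x0 c d "t * K1 s" "t * K2 s"] nx0
          by (simp only: zero_less_norm_iff not_False_eq_True)
      qed
      \<comment> \<open>Strictness comes from \<open>\<mu>' < \<mu> \<theta>\<close>; with the two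
        preceding estimates this is contradictory.\<close>
      moreover have "\<mu>' * u x0 / (norm x0)\<^sup>2 < \<mu> * f x0 * u x0"
      proof -
        have "\<mu>' / (norm x0)\<^sup>2 < \<mu> * (\<theta> / (norm x0)\<^sup>2)"
          using \<mu> nx0 by (simp add: divide_strict_right_mono)
        also have "\<dots> \<le> \<mu> * f x0" using f x0 A \<open>0 < \<mu>\<close> by (intro mult_left_mono) auto
        finally have "\<mu>' / (norm x0)\<^sup>2 * u x0 < \<mu> * f x0 * u x0"
          using u0 by (rule mult_strict_right_mono)
        then show ?thesis by simp
      qed
      ultimately show False by simp
    qed
    then show "princ_eig (pucci c d) f \<Omega> \<le> ereal (\<mu>' / \<theta>)"
      unfolding princ_eig_def by (intro Sup_least) auto
  qed
qed

section \<open>Principal eigenvalues of the Pucci operators\<close>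

text \<open>The upper bound carries two slacks, \<open>\<mu>\<close> above \<open>m\<close> and
  \<open>\<theta>\<close> below \<open>1\<close>, and \<open>\<mu> / \<theta>\<close> can be brought
  as close to \<open>m\<close> as desired.\<close>

lemma eigenvalue_limit:
  fixes G :: "'b \<Rightarrow> ereal"
  assumes ge: "\<forall>\<^sub>F z in F. ereal m \<le> G z"
    and le: "\<And>\<mu> \<theta>. m < \<mu> \<Longrightarrow> 0 < \<theta> \<Longrightarrow> \<theta> < 1 \<Longrightarrow> \<forall>\<^sub>F z in F. G z \<le> ereal (\<mu> / \<theta>)"
    and m: "0 \<le> m"
  shows "(G \<longlongrightarrow> ereal m) F"
proof (rule order_tendstoI)
  show "\<forall>\<^sub>F z in F. y < G z" if "y < ereal m" for y
    using ge by eventually_elim (use that in \<open>rule less_le_trans\<close>)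
next
  fix y assume "ereal m < y"
  then obtain r where r: "m < r" "ereal r < y"
    using ereal_dense2[of "ereal m" y] by auto
  \<comment> \<open>With \<open>\<theta> = \<mu> / r\<close>, which lies in \<open>(0, 1)\<close>,
    the bound \<open>\<mu> / \<theta>\<close> is exactly \<open>r\<close>.\<close>
  define \<mu> where "\<mu> = (m + r) / 2"
  have \<mu>: "m < \<mu>" "0 < \<mu>" "\<mu> < r" using r(1) m by (auto simp: \<mu>_def)
  have "\<forall>\<^sub>F z in F. G z \<le> ereal (\<mu> / (\<mu> / r))"
    using \<mu> by (intro le) auto
  then show "\<forall>\<^sub>F z in F. G z < y"
    using \<mu> r by (auto elim!: eventually_mono)
qed

lemma pucci_eigenvalue:
  fixes c d \<tau> :: real and F :: "real^'n^'n \<Rightarrow> real"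
  defines "F \<equiv> pucci c d"
  assumes cd: "0 < c" "0 < d" and \<tau>: "0 < \<tau>" "d * (real CARD('n) - 1) = c * (2 * \<tau> + 1)"
    and m: "d \<le> c * (real CARD('n) - 1)"
  shows "princ_eig_gamma 2 F = ereal (c * \<tau>\<^sup>2)"
    and "((\<lambda>\<gamma>. princ_eig_gamma \<gamma> F) \<longlongrightarrow> ereal (c * \<tau>\<^sup>2)) (at_left 2)"
    and "((\<lambda>\<delta>. princ_eig F (\<lambda>x. 1 / (norm x)\<^sup>2) (ball 0 1 - cball 0 \<delta>)) \<longlongrightarrow> ereal (c * \<tau>\<^sup>2)) (at_right 0)"
    and "((\<lambda>\<epsilon>. princ_eig F (\<lambda>x. 1 / ((norm x)\<^sup>2 + \<epsilon>\<^sup>2)) (ball 0 1)) \<longlongrightarrow> ereal (c * \<tau>\<^sup>2)) (at_right 0)"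
proof -
  let ?m = "c * \<tau>\<^sup>2"
  let ?u = "\<lambda>x::real^'n. norm x powr (- \<tau>) * (- ln (norm x))"
  have m0: "0 \<le> ?m" using cd by simp
  have sup: "visc_supersol F ?m (\<lambda>x. 1 / (norm x)\<^sup>2) (ball 0 1 - {0}) ?u"
    using log_solution[OF cd \<tau>] by (simp add: F_def solves_punctured_dirichlet_def visc_sol_def)
  have u: "0 < ?u x" if "x \<in> ball 0 1 - {0}" for x
  proof -
    have "0 < - ln (norm x)" using that by simp
    then show ?thesis using that by (intro mult_pos_pos) simp_all
  qed
  \<comment> \<open>Lower bounds from the one logarithmic solution, by shrinking its domain and its
    potential.\<close>
  have ge: "ereal ?m \<le> princ_eig F f \<Omega>"
    if "\<Omega> \<subseteq> ball 0 1 - {0}" "\<And>x. x \<in> \<Omega> \<Longrightarrow> f x \<le> 1 / (norm x)\<^sup>2" for f \<Omega>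
  proof -
    have u: "0 < ?u x" if "x \<in> \<Omega>" for x using \<open>\<Omega> \<subseteq> _\<close> that by (intro u) blast
    show ?thesis
      by (rule princ_eig_ge[OF visc_supersol_mono[OF sup that(1) m0 less_imp_le[OF u] that(2)] u])
  qed
  have powr2: "norm x powr (- 2) = 1 / (norm x)\<^sup>2" for x :: "real^'n"
    by (cases "x = 0") (simp_all add: powr_minus_divide)
  have ge_gamma: "ereal ?m \<le> princ_eig_gamma \<gamma> F" if "\<gamma> \<le> 2" for \<gamma>
    unfolding princ_eig_gamma_def
  proof (rule ge)
    show "norm x powr (- \<gamma>) \<le> 1 / (norm x)\<^sup>2" if "x \<in> ball 0 1 - {0}" for x :: "real^'n"
      using that \<open>\<gamma> \<le> 2\<close> unfolding powr2[symmetric] by (intro powr_mono') auto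
  qed simp
  \<comment> \<open>The annulus is chosen before the domain and the potential, so it stays fixed
    while those vary.\<close>
  have upper: "\<exists>a b. 0 < a \<and> a < b \<and> b < 1 \<and>
      (\<forall>\<Omega> f. (\<forall>x. a \<le> norm x \<longrightarrow> norm x \<le> b \<longrightarrow> x \<in> \<Omega> \<and> \<theta> / (norm x)\<^sup>2 \<le> f x) \<longrightarrow>
        princ_eig F f \<Omega> \<le> ereal (\<mu> / \<theta>))" if "?m < \<mu>" "0 < \<theta>" for \<mu> \<theta>
    unfolding F_def
    by (rule princ_eig_upper[OF cd \<tau> m that(1)]) (use that(2) in blast)
  have gamma_le: "princ_eig_gamma 2 F \<le> ereal \<mu>" if less: "?m < \<mu>" for \<mu>
  proof -
    obtain a b where ab: "0 < a" "a < b" "b < 1" and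
      le: "\<And>\<Omega> f. (\<forall>x. a \<le> norm x \<longrightarrow> norm x \<le> b \<longrightarrow> x \<in> \<Omega> \<and> 1 / (norm x)\<^sup>2 \<le> f x) \<Longrightarrow> princ_eig F f \<Omega> \<le> ereal (\<mu> / 1)"
      using upper[OF less, of 1] by auto
    have "princ_eig F (\<lambda>x. norm x powr (- 2)) (ball 0 1 - {0}) \<le> ereal (\<mu> / 1)"
      unfolding powr2 using ab by (intro le) auto
    then show ?thesis by (simp add: princ_eig_gamma_def)
  qed
  show "princ_eig_gamma 2 F = ereal ?m"
  proof (rule antisym)
    show "princ_eig_gamma 2 F \<le> ereal ?m"
    proof (rule dense_ge)
      fix y assume "ereal ?m < y"
      then obtain r where "?m < r" "ereal r < y" using ereal_dense2[of "ereal ?m" y] by auto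
      then show "princ_eig_gamma 2 F \<le> y" using gamma_le[of r] by auto
    qed
  qed (rule ge_gamma, simp)
  show "((\<lambda>\<gamma>. princ_eig_gamma \<gamma> F) \<longlongrightarrow> ereal ?m) (at_left 2)"
  proof (rule eigenvalue_limit[OF _ _ m0])
    show "\<forall>\<^sub>F \<gamma> in at_left 2. ereal ?m \<le> princ_eig_gamma \<gamma> F"
      using ge_gamma by (auto simp: eventually_at_filter)
    fix \<mu> \<theta> :: real assume \<mu>: "?m < \<mu>" and \<theta>: "0 < \<theta>" "\<theta> < 1"
    obtain a b where ab: "0 < a" "a < b" "b < 1" and
      le: "\<And>\<Omega> f. (\<forall>x. a \<le> norm x \<longrightarrow> norm x \<le> b \<longrightarrow> x \<in> \<Omega> \<and> \<theta> / (norm x)\<^sup>2 \<le> f x) \<Longrightarrow> princ_eig F f \<Omega> \<le> ereal (\<mu> / \<theta>)"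
      using upper[OF \<mu> \<theta>(1)] by auto
    \<comment> \<open>For \<open>a \<le> r\<close> the ratio of \<open>r powr (- \<gamma>)\<close>
      to \<open>r powr (- 2)\<close> is at least \<open>a powr (2 - \<gamma>)\<close>, which tends
      to \<open>1 > \<theta>\<close>.\<close>
    have "((\<lambda>\<gamma>. a powr (2 - \<gamma>)) \<longlongrightarrow> a powr (2 - 2)) (at_left 2)"
      using ab by (intro tendsto_intros) auto
    then have "\<forall>\<^sub>F \<gamma> in at_left 2. \<theta> < a powr (2 - \<gamma>)"
      using \<theta> ab by (intro order_tendstoD(1)) auto
    moreover have "\<forall>\<^sub>F \<gamma> in at_left 2. \<gamma> < (2::real)" by (simp add: eventually_at_filter)
    ultimately show "\<forall>\<^sub>F \<gamma> in at_left 2. princ_eig_gamma \<gamma> F \<le> ereal (\<mu> / \<theta>)"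
    proof eventually_elim
      case (elim \<gamma>)
      have "\<theta> / (norm x)\<^sup>2 \<le> norm x powr (- \<gamma>)" if "a \<le> norm x" for x :: "real^'n"
      proof -
        have "\<theta> \<le> a powr (2 - \<gamma>)" using elim by simp
        also have "\<dots> \<le> norm x powr (2 - \<gamma>)" using that ab elim by (intro powr_mono2) auto
        finally have "\<theta> * norm x powr (- 2) \<le> norm x powr (2 - \<gamma>) * norm x powr (- 2)"
          by (rule mult_right_mono) simp
        also have "\<dots> = norm x powr (- \<gamma>)" by (simp flip: powr_add)
        finally show ?thesis unfolding powr2 by simp
      qed
      then show ?case unfolding princ_eig_gamma_def using ab by (intro le) auto
    qed
  qed
  show "((\<lambda>\<delta>. princ_eig F (\<lambda>x. 1 / (norm x)\<^sup>2) (ball 0 1 - cball 0 \<delta>)) \<longlongrightarrow> ereal ?m) (at_right 0)"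
  proof (rule eigenvalue_limit[OF _ _ m0])
    have "ereal ?m \<le> princ_eig F (\<lambda>x. 1 / (norm x)\<^sup>2) (ball 0 1 - cball 0 \<delta>)" if "0 < \<delta>" for \<delta>
      using that by (intro ge) auto
    then show "\<forall>\<^sub>F \<delta> in at_right 0. ereal ?m \<le> princ_eig F (\<lambda>x. 1 / (norm x)\<^sup>2) (ball 0 1 - cball 0 \<delta>)"
      by (auto simp: eventually_at_filter)
    fix \<mu> \<theta> :: real assume \<mu>: "?m < \<mu>" and \<theta>: "0 < \<theta>" "\<theta> < 1"
    obtain a b where ab: "0 < a" "a < b" "b < 1" and
      le: "\<And>\<Omega> f. (\<forall>x. a \<le> norm x \<longrightarrow> norm x \<le> b \<longrightarrow> x \<in> \<Omega> \<and> \<theta> / (norm x)\<^sup>2 \<le> f x) \<Longrightarrow> princ_eig F f \<Omega> \<le> ereal (\<mu> / \<theta>)"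
      using upper[OF \<mu> \<theta>(1)] by auto
    have "\<forall>\<^sub>F \<delta> in at_right 0. \<delta> < a" using ab by (intro order_tendstoD(2)[OF tendsto_ident_at])
    then show "\<forall>\<^sub>F \<delta> in at_right 0. princ_eig F (\<lambda>x. 1 / (norm x)\<^sup>2) (ball 0 1 - cball 0 \<delta>) \<le> ereal (\<mu> / \<theta>)"
    proof eventually_elim
      case (elim \<delta>)
      show ?case using ab \<theta> elim by (intro le) (auto intro: divide_right_mono)
    qed
  qed
  show "((\<lambda>\<epsilon>. princ_eig F (\<lambda>x. 1 / ((norm x)\<^sup>2 + \<epsilon>\<^sup>2)) (ball 0 1)) \<longlongrightarrow> ereal ?m) (at_right 0)"
  proof (rule eigenvalue_limit[OF _ _ m0])
    \<comment> \<open>The origin belongs to this domain, so the regularized supersolution with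
      \<open>e = \<epsilon>^2\<close> takes over.\<close>
    have "ereal ?m \<le> princ_eig F (\<lambda>x. 1 / ((norm x)\<^sup>2 + \<epsilon>\<^sup>2)) (ball 0 1)" if "0 < \<epsilon>" for \<epsilon>
      unfolding F_def by (rule princ_eig_ge[OF regularized_supersolution[OF cd \<tau>]]) (use that in simp_all)
    then show "\<forall>\<^sub>F \<epsilon> in at_right 0. ereal ?m \<le> princ_eig F (\<lambda>x. 1 / ((norm x)\<^sup>2 + \<epsilon>\<^sup>2)) (ball 0 1)"
      by (auto simp: eventually_at_filter)
    fix \<mu> \<theta> :: real assume \<mu>: "?m < \<mu>" and \<theta>: "0 < \<theta>" "\<theta> < 1"
    obtain a b where ab: "0 < a" "a < b" "b < 1" and
      le: "\<And>\<Omega> f. (\<forall>x. a \<le> norm x \<longrightarrow> norm x \<le> b \<longrightarrow> x \<in> \<Omega> \<and> \<theta> / (norm x)\<^sup>2 \<le> f x) \<Longrightarrow> princ_eig F f \<Omega> \<le> ereal (\<mu> / \<theta>)"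
      using upper[OF \<mu> \<theta>(1)] by auto
    \<comment> \<open>The ratio \<open>r^2 / (r^2 + \<epsilon>^2)\<close> increases with
      \<open>r\<close>, so it exceeds \<open>\<theta>\<close> for all \<open>r \<ge> a\<close> once
      it does at \<open>r = a\<close>.\<close>
    have "((\<lambda>\<epsilon>. \<theta> * (a\<^sup>2 + \<epsilon>\<^sup>2)) \<longlongrightarrow> \<theta> * (a\<^sup>2 + 0\<^sup>2)) (at_right 0)"
      by (intro tendsto_intros)
    then have "\<forall>\<^sub>F \<epsilon> in at_right 0. \<theta> * (a\<^sup>2 + \<epsilon>\<^sup>2) < a\<^sup>2"
      by (rule order_tendstoD(2)) (use \<theta> ab in simp)
    then show "\<forall>\<^sub>F \<epsilon> in at_right 0. princ_eig F (\<lambda>x. 1 / ((norm x)\<^sup>2 + \<epsilon>\<^sup>2)) (ball 0 1) \<le> ereal (\<mu> / \<theta>)"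
    proof eventually_elim
      case (elim \<epsilon>)
      have "\<theta> / (norm x)\<^sup>2 \<le> 1 / ((norm x)\<^sup>2 + \<epsilon>\<^sup>2)" if "a \<le> norm x" for x :: "real^'n"
      proof -
        have pos: "0 < (norm x)\<^sup>2" using that ab(1) by auto
        have "\<theta> * \<epsilon>\<^sup>2 \<le> (1 - \<theta>) * a\<^sup>2" using elim by (simp add: algebra_simps)
        also have "\<dots> \<le> (1 - \<theta>) * (norm x)\<^sup>2"
          using that ab \<theta> by (intro mult_left_mono power_mono) auto
        finally have "\<theta> * ((norm x)\<^sup>2 + \<epsilon>\<^sup>2) \<le> (norm x)\<^sup>2" by (simp add: algebra_simps)
        then show ?thesis using pos by (simp add: divide_le_eq le_divide_eq add_pos_nonneg)
      qed
      then show ?case using ab by (intro le) auto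
    qed
  qed
qed

section \<open>The three claims assembled\<close>

theorem theorem1p2:
  fixes lam Lam Np Nm :: real
    and Mp Mm :: "real^'n^'n \<Rightarrow> real"
  defines "Np \<equiv> Ntilde_plus lam Lam CARD('n)"
    and "Nm \<equiv> Ntilde_minus lam Lam CARD('n)"
    and "Mp \<equiv> pucci_plus lam Lam"
    and "Mm \<equiv> pucci_minus lam Lam"
  assumes "0 < lam" and "lam \<le> Lam" and "Np > 2"
  shows
    "(princ_eig_gamma 2 Mp = ereal (Lam * (Np - 2)\<^sup>2 / 4) \<and>
      solves_punctured_dirichlet Mp (real_of_ereal (princ_eig_gamma 2 Mp))
        (\<lambda>x. norm x powr (- ((Np - 2) / 2)) * (- ln (norm x))) \<and>
      princ_eig_gamma 2 Mm = ereal (lam * (Nm - 2)\<^sup>2 / 4) \<and>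
      solves_punctured_dirichlet Mm (real_of_ereal (princ_eig_gamma 2 Mm))
        (\<lambda>x. norm x powr (- ((Nm - 2) / 2)) * (- ln (norm x)))) \<and>
     (\<forall>F\<in>{Mp, Mm}.
        ((\<lambda>\<gamma>. princ_eig_gamma \<gamma> F) \<longlongrightarrow> princ_eig_gamma 2 F) (at_left 2) \<and>
        ((\<lambda>\<delta>. princ_eig F (\<lambda>x. 1 / (norm x)\<^sup>2) (ball 0 1 - cball 0 \<delta>))
           \<longlongrightarrow> princ_eig_gamma 2 F) (at_right 0) \<and>
        ((\<lambda>\<epsilon>. princ_eig F (\<lambda>x. 1 / ((norm x)\<^sup>2 + \<epsilon>\<^sup>2)) (ball 0 1))
           \<longlongrightarrow> princ_eig_gamma 2 F) (at_right 0)) \<and>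
     (\<forall>F :: real^'n^'n \<Rightarrow> real.
        continuous_on sym_mats F \<longrightarrow> unif_elliptic lam Lam F \<longrightarrow> pos_homogeneous F \<longrightarrow>
        ereal (Lam * (Np - 2)\<^sup>2 / 4) \<le> princ_eig_gamma 2 F \<and>
        princ_eig_gamma 2 F \<le> ereal (lam * (Nm - 2)\<^sup>2 / 4))"
proof -
  let ?N = "real CARD('n) - 1"
  have M: "Mp = pucci Lam lam" "Mm = pucci lam Lam"
    by (simp_all add: Mp_def Mm_def pucci_plus_eq pucci_minus_eq)
  have Lam: "0 < Lam" using assms(5,6) by linarith
  \<comment> \<open>This is \<open>Np > 2\<close> rewritten; it yields
    \<open>d \<le> c (N - 1)\<close> for both choices of the constants.\<close>
  have N: "Lam < lam * ?N"
    using \<open>Np > 2\<close> Lam by (simp add: Np_def Ntilde_plus_def field_simps)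
  then have N0: "0 < ?N" using Lam \<open>0 < lam\<close> by (metis less_trans zero_less_mult_pos)
  have N': "lam < Lam * ?N"
    using N \<open>lam \<le> Lam\<close> mult_right_mono[OF \<open>lam \<le> Lam\<close>, of ?N] N0 by linarith
  have half: "2 * ((n - 2) / 2) + 1 = n - 1" for n :: real
    by (simp add: field_simps)
  have p: "0 < (Np - 2) / 2" "lam * ?N = Lam * (2 * ((Np - 2) / 2) + 1)" "lam \<le> Lam * ?N"
    unfolding half using \<open>Np > 2\<close> Lam N' by (simp_all add: Np_def Ntilde_plus_def)
  have "1 < Lam * ?N / lam" using N' \<open>0 < lam\<close> by (simp add: less_divide_eq)
  then have q: "0 < (Nm - 2) / 2" "Lam * ?N = lam * (2 * ((Nm - 2) / 2) + 1)" "Lam \<le> lam * ?N"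
    unfolding half using N \<open>0 < lam\<close> by (simp_all add: Nm_def Ntilde_minus_def)
  have sq: "k * (n - 2)\<^sup>2 / 4 = k * ((n - 2) / 2)\<^sup>2" for k n :: real by (simp add: power_divide)
  note ep = pucci_eigenvalue[OF Lam \<open>0 < lam\<close> p, folded M(1)]
    and em = pucci_eigenvalue[OF \<open>0 < lam\<close> Lam q, folded M(2)]
  \<comment> \<open>Larger operators have smaller eigenvalues, so the bounds
    \<open>Mm \<le> F \<le> Mp\<close> on symmetric matrices reverse.\<close>
  have "princ_eig_gamma 2 Mp \<le> princ_eig_gamma 2 F" "princ_eig_gamma 2 F \<le> princ_eig_gamma 2 Mm"
    if "unif_elliptic lam Lam F" "pos_homogeneous F" for F :: "real^'n^'n \<Rightarrow> real"
    unfolding princ_eig_gamma_def M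
    by (intro princ_eig_operator_mono elliptic_pucci_bounds[OF that]; assumption)+
  then show ?thesis
    using ep em log_solution[OF Lam \<open>0 < lam\<close> p(1,2)] log_solution[OF \<open>0 < lam\<close> Lam q(1,2)]
    by (simp add: sq flip: M)
qed

end
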